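(* Let $\lambda_0\ge0$, $\lambda_1\ge0$. (i) If there exists a strategy $(\chi,\psi)\in\mathscr F$ such that $$L(\chi,\psi)=\inf_{(\chi',\psi')\in\mathscr F}L(\chi',\psi'),\qquad ( * )$$ then for every $k=1,2,\dots$ $$I_{\{g(Z_k^\chi)<1+R(Z_k^\chi)\}}\le\psi_k^\chi\le I_{\{g(Z_k^\chi)\le1+R(Z_k^\chi)\}}\qquad (a)$$ $P_{\theta_0}^\chi$-almost surely on $\{y^{(k)}:(1-\psi_1^\chi(y^{(1)}))\cdots(1-\psi_{k-1}^\chi(y^{(k-1)}))>0\}$, and $$\int f_{\theta_0}(y|\chi_{k+1})\,\rho\!\left(Z_k^\chi\frac{f_{\theta_1}(y|\chi_{k+1})}{f_{\theta_0}(y|\chi_{k+1})}\right)d\mu(y)=R(Z_k^\chi)\qquad (b)$$ $P_{\theta_0}^\chi$-almost surely on $\{y^{(k)}:(1-\psi_1^\chi(y^{(1)}))\cdots(1-\psi_k^\chi(y^{(k)}))>0\}$, and moreover $\chi_1$ is such that $$\int f_{\theta_0}(y|\chi_1)\,\rho\!\left(\frac{f_{\theta_1}(y|\chi_1)}{f_{\theta_0}(y|\chi_1)}\right)d\mu(y)=R(1).\qquad (c)$$ (ii) Conversely, if a strategy $(\chi,\psi)$ satisfies, for every $k=1,2,\dots$, (a) and (b) $P_{\theta_0}^\chi$-almost surely on the respective sets indicated in (i), and $\chi_1$ satisfies (c), then $(\chi,\psi)\in\mathscr F$ and $(\chi,\psi)$ satisfies $( * )$.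
   Context: Model. Controls $x$ take values in a measurable space; responses $y$ take values in a measurable space with a $\sigma$-finite measure $\mu$. For $\theta\in\{\theta_0,\theta_1\}$, $f_\theta(y|x)$ (measurable in $(x,y)$) is the density with respect to $\mu$ of the response when control $x$ is applied. Given controls, observations are independent; with $x^{(n)}=(x_1,\dots,x_n)$, $y^{(n)}=(y_1,\dots,y_n)$ put $f_\theta^n=f_\theta^n(x^{(n)},y^{(n)})=\prod_{i=1}^n f_\theta(y_i|x_i)$, a density with respect to the product measure $\mu^n=\mu\otimes\dots\otimes\mu$. A control policy is $\chi=(\chi_1,\chi_2,\dots)$ with $\chi_n=\chi_n(x^{(n-1)},y^{(n-1)})$ measurable, with values in the control space ($\chi_1$ is a constant); the control at stage $n$ is $x_n=\chi_n(x^{(n-1)},y^{(n-1)})$. A stopping rule is $\psi=(\psi_1,\psi_2,\dots)$ with $\psi_n=\psi_n(x^{(n)},y^{(n)})\in[0,1]$ measurable, the conditional probability of stopping at stage $n$. A pair $(\chi,\psi)$ is called a strategy. For any function $F_n=F_n(x^{(n)},y^{(n)})$ let $F_n^\chi(y^{(n)})=F_n(x^{(n)},y^{(n)})$ with $x_i=\chi_i(x^{(i-1)},y^{(i-1)})$, $i=1,\dots,n$; in particular $f_\theta^{n,\chi}=(f_\theta^n)^\chi$. $P_\theta^\chi$ is the law of the observations under $\theta$ and $\chi$: $y^{(n)}$ has density $f_\theta^{n,\chi}$ with respect to $\mu^n$, and $E_\theta^\chi F_n=\int F_n^\chi f_\theta^{n,\chi}d\mu^n$. The stopping time $\tau_\psi$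 has $P_\theta^\chi(\tau_\psi=n)=E_\theta^\chi(1-\psi_1)\cdots(1-\psi_{n-1})\psi_n$. $\mathscr F$ is the set of strategies with $\lim_{n\to\infty}E_{\theta_0}^\chi(1-\psi_1)\cdots(1-\psi_n)=0$, equivalently $P_{\theta_0}^\chi(\tau_\psi<\infty)=1$. Let $s_n^{\psi,\chi}=(1-\psi_1^\chi)\cdots(1-\psi_{n-1}^\chi)\psi_n^\chi$, $l_n=\min\{\lambda_0f_{\theta_0}^n,\lambda_1f_{\theta_1}^n\}$, and for $(\chi,\psi)\in\mathscr F$ $$L(\chi,\psi)=\sum_{n=1}^\infty\int s_n^{\psi,\chi}\,(nf_{\theta_0}^{n,\chi}+l_n^\chi)\,d\mu^n .$$ Likelihood ratio: $Z_n=Z_n(x^{(n)},y^{(n)})=\prod_{i=1}^n\frac{f_{\theta_1}(y_i|x_i)}{f_{\theta_0}(y_i|x_i)}$. For $z\ge0$ let $\rho_0(z)=g(z)=\min\{\lambda_0,\lambda_1z\}$ and, for $k=1,2,\dots$, $$\rho_k(z)=\min\Big\{g(z),\,1+\min_x\int f_{\theta_0}(y|x)\,\rho_{k-1}\Big(z\frac{f_{\theta_1}(y|x)}{f_{\theta_0}(y|x)}\Big)d\mu(y)\Big\}.$$ The sequence $\rho_k(z)$ is non-increasing in $k$; $\rho(z)=\lim_{k\to\infty}\rho_k(z)$, and $$R(z)=\min_x\int f_{\theta_0}(y|x)\,\rho\Big(z\frac{f_{\theta_1}(y|x)}{f_{\theta_0}(y|x)}\Big)d\mu(y).$$ (Integrands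 with the factor $f_{\theta_0}(y|x)$ are taken to be $0$ where $f_{\theta_0}(y|x)=0$.) Standing assumption: the functions $\rho_k$ and $R$ are well defined (minima exist) and measurable. Likewise, with $V_N^N=l_N$, $V_{k-1}^N=\min\{l_{k-1},f_{\theta_0}^{k-1}+R_{k-1}^N\}$ for $k=N,\dots,2$, $R_{k-1}^N(x^{(k-1)},y^{(k-1)})=\min_{x_k}\int V_k^N(x^{(k)},y^{(k)})d\mu(y_k)$ and $R_0^N=\min_{x_1}\int V_1^N(x_1,y_1)\,d\mu(y_1)$, all $R_k^N$ are well defined and measurable and $R_0^N$ is well defined (all this is true, e.g., if the controls can take only finitely many values). $I_A$ denotes the indicator of $A$. *)

theory Defs
  imports "HOL-Analysis.Analysis"
begin

datatype hyp = Th0 | Th1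

text \<open>
  The history \<open>x\<^sup>(\<^sup>n\<^sup>)\<close> (resp. \<open>y\<^sup>(\<^sup>n\<^sup>)\<close>) is an element of the product over the index set
  \<open>{1..n}\<close>, i.e. a function that is \<open>undefined\<close> outside \<open>{1..n}\<close>; the empty history is
  \<open>\<lambda>_. undefined\<close>. Policies are written \<open>\<kappa>\<close>. Of the
  measure \<open>X\<close> on controls only the measurable space is used.
\<close>

abbreviation hist_space :: "nat \<Rightarrow> 'a measure \<Rightarrow> (nat \<Rightarrow> 'a) measure" where
  "hist_space n M \<equiv> PiM {1..n} (\<lambda>_. M)"

type_synonym ('x, 'y) policy = "nat \<Rightarrow> (nat \<Rightarrow> 'x) \<Rightarrow> (nat \<Rightarrow> 'y) \<Rightarrow> 'x"
type_synonym ('x, 'y) stopping = "nat \<Rightarrow> (nat \<Rightarrow> 'x) \<Rightarrow> (nat \<Rightarrow> 'y) \<Rightarrow> real"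

definition response_density :: "'x measure \<Rightarrow> 'y measure \<Rightarrow> ('x \<Rightarrow> 'y \<Rightarrow> real) \<Rightarrow> bool" where
  "response_density X \<mu> p \<longleftrightarrow>
     (\<lambda>(x, y). p x y) \<in> borel_measurable (X \<Otimes>\<^sub>M \<mu>) \<and>
     (\<forall>x\<in>space X. \<forall>y\<in>space \<mu>. 0 \<le> p x y) \<and>
     (\<forall>x\<in>space X. (\<integral>\<^sup>+ y. ennreal (p x y) \<partial>\<mu>) = 1)"

definition strategy ::
  "'x measure \<Rightarrow> 'y measure \<Rightarrow> ('x, 'y) policy \<Rightarrow> ('x, 'y) stopping \<Rightarrow> bool" where
  "strategy X \<mu> \<kappa> \<psi> \<longleftrightarrow>
     (\<forall>n\<ge>1. (\<lambda>(xs, ys). \<kappa> n xs ys)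
        \<in> measurable (hist_space (n - 1) X \<Otimes>\<^sub>M hist_space (n - 1) \<mu>) X) \<and>
     (\<forall>n\<ge>1. (\<lambda>(xs, ys). \<psi> n xs ys)
        \<in> borel_measurable (hist_space n X \<Otimes>\<^sub>M hist_space n \<mu>)) \<and>
     (\<forall>n\<ge>1. \<forall>xs\<in>space (hist_space n X). \<forall>ys\<in>space (hist_space n \<mu>).
        0 \<le> \<psi> n xs ys \<and> \<psi> n xs ys \<le> 1)"

primrec controls :: "('x, 'y) policy \<Rightarrow> (nat \<Rightarrow> 'y) \<Rightarrow> nat \<Rightarrow> nat \<Rightarrow> 'x" where
  "controls \<kappa> ys 0 = (\<lambda>_. undefined)"
| "controls \<kappa> ys (Suc n) =
     (controls \<kappa> ys n)(Suc n := \<kappa> (Suc n) (controls \<kappa> ys n) (restrict ys {1..n}))"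

text \<open>\<open>F\<^sub>n\<^sup>\<kappa>\<close>; the argument \<open>ys\<close> may be a history longer than \<open>n\<close>.\<close>

definition under ::
  "('x, 'y) policy \<Rightarrow> (nat \<Rightarrow> (nat \<Rightarrow> 'x) \<Rightarrow> (nat \<Rightarrow> 'y) \<Rightarrow> 'r) \<Rightarrow> nat \<Rightarrow> (nat \<Rightarrow> 'y) \<Rightarrow> 'r" where
  "under \<kappa> F n ys = F n (controls \<kappa> ys n) (restrict ys {1..n})"

text \<open>\<open>\<kappa>\<^sub>n\<^sub>+\<^sub>1\<close> after the responses \<open>y\<^sub>1, \<dots>, y\<^sub>n\<close>; for \<open>n = 0\<close> it does not depend on \<open>ys\<close>.\<close>

definition next_control :: "('x, 'y) policy \<Rightarrow> nat \<Rightarrow> (nat \<Rightarrow> 'y) \<Rightarrow> 'x" where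
  "next_control \<kappa> n ys = \<kappa> (Suc n) (controls \<kappa> ys n) (restrict ys {1..n})"

definition first_control :: "('x, 'y) policy \<Rightarrow> 'x" where
  "first_control \<kappa> = \<kappa> 1 (\<lambda>_. undefined) (\<lambda>_. undefined)"

definition lik ::
  "(hyp \<Rightarrow> 'x \<Rightarrow> 'y \<Rightarrow> real) \<Rightarrow> hyp \<Rightarrow> nat \<Rightarrow> (nat \<Rightarrow> 'x) \<Rightarrow> (nat \<Rightarrow> 'y) \<Rightarrow> real" where
  "lik f \<theta> n xs ys = (\<Prod>i=1..n. f \<theta> (xs i) (ys i))"

text \<open>
  Division by zero (value 0) in the likelihood ratio only occurs where the density
  under \<open>Th0\<close> vanishes.
\<close>

definition lik_ratio ::
  "(hyp \<Rightarrow> 'x \<Rightarrow> 'y \<Rightarrow> real) \<Rightarrow> nat \<Rightarrow> (nat \<Rightarrow> 'x) \<Rightarrow> (nat \<Rightarrow> 'y) \<Rightarrow> real" where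
  "lik_ratio f n xs ys = (\<Prod>i=1..n. f Th1 (xs i) (ys i) / f Th0 (xs i) (ys i))"

definition response_law ::
  "'y measure \<Rightarrow> (hyp \<Rightarrow> 'x \<Rightarrow> 'y \<Rightarrow> real) \<Rightarrow> hyp \<Rightarrow> ('x, 'y) policy \<Rightarrow> nat \<Rightarrow> (nat \<Rightarrow> 'y) measure" where
  "response_law \<mu> f \<theta> \<kappa> n = density (hist_space n \<mu>) (\<lambda>ys. ennreal (under \<kappa> (lik f \<theta>) n ys))"

definition continue_prob ::
  "('x, 'y) policy \<Rightarrow> ('x, 'y) stopping \<Rightarrow> nat \<Rightarrow> (nat \<Rightarrow> 'y) \<Rightarrow> real" where
  "continue_prob \<kappa> \<psi> n ys = (\<Prod>i=1..n. 1 - under \<kappa> \<psi> i ys)"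

definition stop_prob ::
  "('x, 'y) policy \<Rightarrow> ('x, 'y) stopping \<Rightarrow> nat \<Rightarrow> (nat \<Rightarrow> 'y) \<Rightarrow> real" where
  "stop_prob \<kappa> \<psi> n ys = continue_prob \<kappa> \<psi> (n - 1) ys * under \<kappa> \<psi> n ys"

definition terminating ::
  "'x measure \<Rightarrow> 'y measure \<Rightarrow> (hyp \<Rightarrow> 'x \<Rightarrow> 'y \<Rightarrow> real) \<Rightarrow>
     (('x, 'y) policy \<times> ('x, 'y) stopping) set" where
  "terminating X \<mu> f = {(\<kappa>, \<psi>). strategy X \<mu> \<kappa> \<psi> \<and>
     (\<lambda>n. \<integral>\<^sup>+ ys. ennreal (continue_prob \<kappa> \<psi> n ys) \<partial>response_law \<mu> f Th0 \<kappa> n) \<longlonglongrightarrow> 0}"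

definition decision_loss ::
  "(hyp \<Rightarrow> 'x \<Rightarrow> 'y \<Rightarrow> real) \<Rightarrow> (hyp \<Rightarrow> real) \<Rightarrow> nat \<Rightarrow> (nat \<Rightarrow> 'x) \<Rightarrow> (nat \<Rightarrow> 'y) \<Rightarrow> real" where
  "decision_loss f lam n xs ys = min (lam Th0 * lik f Th0 n xs ys) (lam Th1 * lik f Th1 n xs ys)"

text \<open>The sum over \<open>n \<ge> 1\<close> is indexed from 0. The value may be infinite.\<close>

definition risk ::
  "'y measure \<Rightarrow> (hyp \<Rightarrow> 'x \<Rightarrow> 'y \<Rightarrow> real) \<Rightarrow> (hyp \<Rightarrow> real) \<Rightarrow>
     ('x, 'y) policy \<Rightarrow> ('x, 'y) stopping \<Rightarrow> ennreal" where
  "risk \<mu> f lam \<kappa> \<psi> = (\<Sum>m. let n = Suc m in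
     \<integral>\<^sup>+ ys. ennreal (stop_prob \<kappa> \<psi> n ys *
       (real n * under \<kappa> (lik f Th0) n ys + under \<kappa> (decision_loss f lam) n ys))
       \<partial>hist_space n \<mu>)"

definition optimal ::
  "'x measure \<Rightarrow> 'y measure \<Rightarrow> (hyp \<Rightarrow> 'x \<Rightarrow> 'y \<Rightarrow> real) \<Rightarrow> (hyp \<Rightarrow> real) \<Rightarrow>
     ('x, 'y) policy \<Rightarrow> ('x, 'y) stopping \<Rightarrow> bool" where
  "optimal X \<mu> f lam \<kappa> \<psi> \<longleftrightarrow>
     risk \<mu> f lam \<kappa> \<psi> = (INF (\<kappa>', \<psi>')\<in>terminating X \<mu> f. risk \<mu> f lam \<kappa>' \<psi>')"

text \<open>
  Minima over the control space are written as infima; that they are attained is the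
  separate condition \<open>has_min\<close>.
\<close>

definition has_min :: "'a set \<Rightarrow> ('a \<Rightarrow> real) \<Rightarrow> bool" where
  "has_min A h \<longleftrightarrow> (\<exists>a\<in>A. \<forall>b\<in>A. h a \<le> h b)"

definition g_fun :: "(hyp \<Rightarrow> real) \<Rightarrow> real \<Rightarrow> real" where
  "g_fun lam z = min (lam Th0) (lam Th1 * z)"

definition step_value ::
  "'y measure \<Rightarrow> (hyp \<Rightarrow> 'x \<Rightarrow> 'y \<Rightarrow> real) \<Rightarrow> (real \<Rightarrow> real) \<Rightarrow> real \<Rightarrow> 'x \<Rightarrow> real" where
  "step_value \<mu> f h z x = (\<integral> y. f Th0 x y * h (z * (f Th1 x y / f Th0 x y)) \<partial>\<mu>)"

primrec rho_seq ::
  "'x measure \<Rightarrow> 'y measure \<Rightarrow> (hyp \<Rightarrow> 'x \<Rightarrow> 'y \<Rightarrow> real) \<Rightarrow> (hyp \<Rightarrow> real) \<Rightarrow> nat \<Rightarrow> real \<Rightarrow> real" where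
  "rho_seq X \<mu> f lam 0 = g_fun lam"
| "rho_seq X \<mu> f lam (Suc k) =
     (\<lambda>z. min (g_fun lam z) (1 + (INF x\<in>space X. step_value \<mu> f (rho_seq X \<mu> f lam k) z x)))"

definition rho ::
  "'x measure \<Rightarrow> 'y measure \<Rightarrow> (hyp \<Rightarrow> 'x \<Rightarrow> 'y \<Rightarrow> real) \<Rightarrow> (hyp \<Rightarrow> real) \<Rightarrow> real \<Rightarrow> real" where
  "rho X \<mu> f lam z = lim (\<lambda>k. rho_seq X \<mu> f lam k z)"

definition R_fun ::
  "'x measure \<Rightarrow> 'y measure \<Rightarrow> (hyp \<Rightarrow> 'x \<Rightarrow> 'y \<Rightarrow> real) \<Rightarrow> (hyp \<Rightarrow> real) \<Rightarrow> real \<Rightarrow> real" where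
  "R_fun X \<mu> f lam z = (INF x\<in>space X. step_value \<mu> f (rho X \<mu> f lam) z x)"

text \<open>\<open>V_trunc \<dots> N k\<close> is \<open>V\<^sub>k\<^sup>N\<close>, defined by backward recursion in \<open>k\<close>.\<close>

function V_trunc ::
  "'x measure \<Rightarrow> 'y measure \<Rightarrow> (hyp \<Rightarrow> 'x \<Rightarrow> 'y \<Rightarrow> real) \<Rightarrow> (hyp \<Rightarrow> real) \<Rightarrow>
     nat \<Rightarrow> nat \<Rightarrow> (nat \<Rightarrow> 'x) \<Rightarrow> (nat \<Rightarrow> 'y) \<Rightarrow> real" where
  "V_trunc X \<mu> f lam N k xs ys =
     (if k < N then
        min (decision_loss f lam k xs ys)
          (lik f Th0 k xs ys + (INF x\<in>space X.
             \<integral> y. V_trunc X \<mu> f lam N (Suc k) (xs(Suc k := x)) (ys(Suc k := y)) \<partial>\<mu>))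
      else decision_loss f lam k xs ys)"
  by pat_completeness auto
termination
  by (relation "Wellfounded.measure (\<lambda>(X, \<mu>, f, lam, N, k, xs, ys). N - k)") auto

declare V_trunc.simps [simp del]

definition V_step ::
  "'x measure \<Rightarrow> 'y measure \<Rightarrow> (hyp \<Rightarrow> 'x \<Rightarrow> 'y \<Rightarrow> real) \<Rightarrow> (hyp \<Rightarrow> real) \<Rightarrow>
     nat \<Rightarrow> nat \<Rightarrow> (nat \<Rightarrow> 'x) \<Rightarrow> (nat \<Rightarrow> 'y) \<Rightarrow> 'x \<Rightarrow> real" where
  "V_step X \<mu> f lam N k xs ys x =
     (\<integral> y. V_trunc X \<mu> f lam N (Suc k) (xs(Suc k := x)) (ys(Suc k := y)) \<partial>\<mu>)"

definition R_trunc ::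
  "'x measure \<Rightarrow> 'y measure \<Rightarrow> (hyp \<Rightarrow> 'x \<Rightarrow> 'y \<Rightarrow> real) \<Rightarrow> (hyp \<Rightarrow> real) \<Rightarrow>
     nat \<Rightarrow> nat \<Rightarrow> (nat \<Rightarrow> 'x) \<Rightarrow> (nat \<Rightarrow> 'y) \<Rightarrow> real" where
  "R_trunc X \<mu> f lam N k xs ys = (INF x\<in>space X. V_step X \<mu> f lam N k xs ys x)"

definition rho_well_defined ::
  "'x measure \<Rightarrow> 'y measure \<Rightarrow> (hyp \<Rightarrow> 'x \<Rightarrow> 'y \<Rightarrow> real) \<Rightarrow> (hyp \<Rightarrow> real) \<Rightarrow> bool" where
  "rho_well_defined X \<mu> f lam \<longleftrightarrow>
     (\<forall>k. \<forall>z\<ge>0. has_min (space X) (step_value \<mu> f (rho_seq X \<mu> f lam k) z)) \<and>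
     (\<forall>k. rho_seq X \<mu> f lam k \<in> borel_measurable (restrict_space borel {0..})) \<and>
     (\<forall>z\<ge>0. has_min (space X) (step_value \<mu> f (rho X \<mu> f lam) z)) \<and>
     R_fun X \<mu> f lam \<in> borel_measurable (restrict_space borel {0..})"

definition R_trunc_well_defined ::
  "'x measure \<Rightarrow> 'y measure \<Rightarrow> (hyp \<Rightarrow> 'x \<Rightarrow> 'y \<Rightarrow> real) \<Rightarrow> (hyp \<Rightarrow> real) \<Rightarrow> bool" where
  "R_trunc_well_defined X \<mu> f lam \<longleftrightarrow>
     (\<forall>N. \<forall>k<N.
        (\<forall>xs\<in>space (hist_space k X). \<forall>ys\<in>space (hist_space k \<mu>).
           has_min (space X) (V_step X \<mu> f lam N k xs ys)) \<and>
        (\<lambda>(xs, ys). R_trunc X \<mu> f lam N k xs ys)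
          \<in> borel_measurable (hist_space k X \<Otimes>\<^sub>M hist_space k \<mu>))"

definition stopping_condition ::
  "'x measure \<Rightarrow> 'y measure \<Rightarrow> (hyp \<Rightarrow> 'x \<Rightarrow> 'y \<Rightarrow> real) \<Rightarrow> (hyp \<Rightarrow> real) \<Rightarrow>
     ('x, 'y) policy \<Rightarrow> ('x, 'y) stopping \<Rightarrow> nat \<Rightarrow> bool" where
  "stopping_condition X \<mu> f lam \<kappa> \<psi> k \<longleftrightarrow>
     (AE ys in response_law \<mu> f Th0 \<kappa> k. continue_prob \<kappa> \<psi> (k - 1) ys > 0 \<longrightarrow>
        (let z = under \<kappa> (lik_ratio f) k ys in
           of_bool (g_fun lam z < 1 + R_fun X \<mu> f lam z) \<le> under \<kappa> \<psi> k ys \<and>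
           under \<kappa> \<psi> k ys \<le> of_bool (g_fun lam z \<le> 1 + R_fun X \<mu> f lam z)))"

definition control_condition ::
  "'x measure \<Rightarrow> 'y measure \<Rightarrow> (hyp \<Rightarrow> 'x \<Rightarrow> 'y \<Rightarrow> real) \<Rightarrow> (hyp \<Rightarrow> real) \<Rightarrow>
     ('x, 'y) policy \<Rightarrow> ('x, 'y) stopping \<Rightarrow> nat \<Rightarrow> bool" where
  "control_condition X \<mu> f lam \<kappa> \<psi> k \<longleftrightarrow>
     (AE ys in response_law \<mu> f Th0 \<kappa> k. continue_prob \<kappa> \<psi> k ys > 0 \<longrightarrow>
        (let z = under \<kappa> (lik_ratio f) k ys in
           step_value \<mu> f (rho X \<mu> f lam) z (next_control \<kappa> k ys) = R_fun X \<mu> f lam z))"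

definition first_control_condition ::
  "'x measure \<Rightarrow> 'y measure \<Rightarrow> (hyp \<Rightarrow> 'x \<Rightarrow> 'y \<Rightarrow> real) \<Rightarrow> (hyp \<Rightarrow> real) \<Rightarrow>
     ('x, 'y) policy \<Rightarrow> bool" where
  "first_control_condition X \<mu> f lam \<kappa> \<longleftrightarrow>
     step_value \<mu> f (rho X \<mu> f lam) 1 (first_control \<kappa>) = R_fun X \<mu> f lam 1"

end

theory Submission
  imports Defs
begin

text \<open>
  Divide all densities by the density under \<open>Th0\<close>. The problem becomes one of optimal control and
  stopping for the likelihood ratio \<open>Z\<^sub>n\<close> under \<open>Th0\<close>, where stopping after \<open>n\<close> observations costs
  \<open>n + g(Z\<^sub>n)\<close>. The limit \<open>\<rho>\<close> of the truncated values satisfies Bellman's equation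
  \<open>\<rho> = min g (1 + R)\<close> (lemma \<open>bellman\<close>).

  Fix a strategy. Write \<open>c\<^sub>n\<close> for the probability, given the responses, that it is still running after
  \<open>n\<close> stages, \<open>S\<^sub>n\<close> for the mean of \<open>\<rho>(Z\<^sub>n\<^sub>+\<^sub>1)\<close> given the first \<open>n\<close> responses, and
  \<open>T\<^sub>n = E (c\<^sub>n (n + 1 + S\<^sub>n))\<close> for the cost that would follow if one more observation were taken and
  the optimal value were charged from then on. Comparing \<open>T\<^sub>n\<close> with \<open>T\<^sub>n\<^sub>+\<^sub>1\<close> plus the cost of stopping at
  stage \<open>n + 1\<close> leaves a nonnegative excess \<open>D\<^sub>n\<close>, the expectation of
  \<open>c\<^sub>n (\<psi> (g - \<rho>) + (1 - \<psi>) (1 + S - \<rho>))\<close> at stage \<open>n + 1\<close> (lemma \<open>one_stage\<close>). By Bellman's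
  equation \<open>D\<^sub>n\<close> vanishes exactly when the stopping condition and the control condition hold at that
  stage (lemma \<open>excess_eq_0_iff\<close>). Summation over the stages gives the following.

  \<^item> A strategy for which \<open>T\<^sub>0 + \<Sum>n. D\<^sub>n\<close> is finite is terminating, because this sum bounds every
    \<open>T\<^sub>n\<close>, which in turn dominates \<open>n E c\<^sub>n\<close>.
  \<^item> For a terminating strategy the risk equals \<open>T\<^sub>0 + \<Sum>n. D\<^sub>n\<close>: the remainder \<open>T\<^sub>n\<close> is absorbed by the
    costs of those who stop later (lemmas \<open>risk_le\<close> and \<open>risk_ge\<close>).

  Here \<open>T\<^sub>0\<close> is one plus the one-step value of the first control, hence at least \<open>1 + R 1\<close>. So
  \<open>1 + R 1\<close> is a lower bound for the risk, and it is attained precisely under the three conditions.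

  For the necessity of these conditions it remains to see that \<open>1 + R 1\<close> is the infimum of the risk
  even if it is not attained. The controls form an arbitrary measurable space, where minimisers
  need not admit a measurable selection. However, the one-step values are Lipschitz in
  the likelihood ratio with a constant that does not depend on the control, so nearly optimal
  controls can be chosen constant on the cells of a grid (lemma \<open>measurable_near_minimiser\<close>). With
  summable tolerances this produces strategies whose risk is arbitrarily close to the bound
  (lemma \<open>near_optimal_strategy\<close>).
\<close>

section \<open>One-step values\<close>

locale controlled_test =
  fixes X :: "'x measure" and \<mu> :: "'y measure"
    and f :: "hyp \<Rightarrow> 'x \<Rightarrow> 'y \<Rightarrow> real" and lam :: "hyp \<Rightarrow> real"
  assumes sigma_finite: "sigma_finite_measure \<mu>"
    and density: "response_density X \<mu> (f \<theta>)"
    and lam_nonneg: "0 \<le> lam \<theta>"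
    and well_defined: "rho_well_defined X \<mu> f lam"

sublocale controlled_test \<subseteq> sigma_finite_measure \<mu>
  by (rule sigma_finite)

context controlled_test
begin

abbreviation "\<rho> \<equiv> rho X \<mu> f lam"
abbreviation "R \<equiv> R_fun X \<mu> f lam"
abbreviation "ratio x y \<equiv> f Th1 x y / f Th0 x y"

lemma space_nonempty: "space X \<noteq> {}"
  using well_defined unfolding rho_well_defined_def has_min_def by (metis empty_iff order_refl)

lemma density_measurable_compose:
  assumes "p \<in> measurable M X" "q \<in> measurable M \<mu>"
  shows "(\<lambda>a. f \<theta> (p a) (q a)) \<in> borel_measurable M"
  using measurable_compose[OF measurable_Pair[OF assms], of "\<lambda>(x, y). f \<theta> x y"]
    density[of \<theta>] by (simp add: response_density_def)

lemma density_measurable: "x \<in> space X \<Longrightarrow> f \<theta> x \<in> borel_measurable \<mu>"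
  using density_measurable_compose[of "\<lambda>_. x" \<mu> "\<lambda>y. y" \<theta>] by simp

lemma density_nonneg: "x \<in> space X \<Longrightarrow> y \<in> space \<mu> \<Longrightarrow> 0 \<le> f \<theta> x y"
  using density by (simp add: response_density_def)

lemma nn_integral_density_eq_1: "x \<in> space X \<Longrightarrow> (\<integral>\<^sup>+ y. ennreal (f \<theta> x y) \<partial>\<mu>) = 1"
  using density by (simp add: response_density_def)

lemma has_bochner_density: "x \<in> space X \<Longrightarrow> has_bochner_integral \<mu> (f \<theta> x) 1"
  by (rule has_bochner_integral_nn_integral)
     (auto simp: nn_integral_density_eq_1 intro: AE_I2 density_nonneg density_measurable)

lemma integrable_density: "x \<in> space X \<Longrightarrow> integrable \<mu> (f \<theta> x)"
  and integral_density: "x \<in> space X \<Longrightarrow> (\<integral> y. f \<theta> x y \<partial>\<mu>) = 1"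
  using has_bochner_density[of x \<theta>] by (auto simp: has_bochner_integral_iff)

lemma ratio_nonneg: "x \<in> space X \<Longrightarrow> y \<in> space \<mu> \<Longrightarrow> 0 \<le> ratio x y"
  by (simp add: density_nonneg)

text \<open>
  The class of value functions closed under every operation of the recursion: averaging over the
  next response, minimising over controls, taking the minimum with \<open>g\<close>, and passing to limits.
  The second clause is Lipschitz continuity; it supplies measurability, and it is what makes
  near-optimal strategies available.
\<close>

definition admissible :: "(real \<Rightarrow> real) \<Rightarrow> bool" where
  "admissible h \<longleftrightarrow> (\<forall>z\<ge>0. 0 \<le> h z \<and> h z \<le> lam Th0) \<and>
     (\<forall>z\<ge>0. \<forall>w\<ge>0. h z \<le> h w + lam Th1 * \<bar>z - w\<bar>)"

lemma admissible_nonneg: "admissible h \<Longrightarrow> 0 \<le> z \<Longrightarrow> 0 \<le> h z"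
  and admissible_le: "admissible h \<Longrightarrow> 0 \<le> z \<Longrightarrow> h z \<le> lam Th0"
  and admissible_lipschitz:
    "admissible h \<Longrightarrow> 0 \<le> z \<Longrightarrow> 0 \<le> w \<Longrightarrow> h z \<le> h w + lam Th1 * \<bar>z - w\<bar>"
  by (auto simp: admissible_def)

lemma admissible_measurable:
  assumes "admissible h" "p \<in> borel_measurable M" "\<And>a. a \<in> space M \<Longrightarrow> 0 \<le> p a"
  shows "(\<lambda>a. h (p a)) \<in> borel_measurable M"
proof -
  have "(lam Th1)-lipschitz_on {0..} h"
  proof (rule lipschitz_onI)
    fix z w :: real assume "z \<in> {0..}" "w \<in> {0..}"
    then show "dist (h z) (h w) \<le> lam Th1 * dist z w"
      using admissible_lipschitz[OF assms(1), of z w] admissible_lipschitz[OF assms(1), of w z]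
      by (auto simp: dist_real_def abs_minus_commute)
  qed (rule lam_nonneg)
  then have "continuous_on {0..} h"
    by (rule lipschitz_on_continuous_on)
  then have "h \<in> borel_measurable (restrict_space borel {0..})"
    by (rule borel_measurable_continuous_on_restrict)
  moreover have "p \<in> measurable M (restrict_space borel {0..})"
    using assms by (intro measurable_restrict_space2) auto
  ultimately show ?thesis
    by (rule measurable_compose[rotated])
qed

lemma step_integrand_nonneg:
  assumes "admissible h" "0 \<le> z" "x \<in> space X" "y \<in> space \<mu>"
  shows "0 \<le> f Th0 x y * h (z * ratio x y)"
  using assms by (intro mult_nonneg_nonneg density_nonneg admissible_nonneg[OF assms(1)] ratio_nonneg)

lemma step_integrable:
  assumes h: "admissible h" and z: "0 \<le> z" and x: "x \<in> space X"
  shows "integrable \<mu> (\<lambda>y. f Th0 x y * h (z * ratio x y))"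
proof (rule Bochner_Integration.integrable_bound)
  show "integrable \<mu> (\<lambda>y. f Th0 x y * lam Th0)"
    using integrable_density[OF x] by simp
  have "(\<lambda>y. h (z * ratio x y)) \<in> borel_measurable \<mu>"
    using x z
    by (intro admissible_measurable[OF h] borel_measurable_times borel_measurable_divide
        borel_measurable_const density_measurable mult_nonneg_nonneg ratio_nonneg)
  then show "(\<lambda>y. f Th0 x y * h (z * ratio x y)) \<in> borel_measurable \<mu>"
    by (intro borel_measurable_times density_measurable x)
  show "AE y in \<mu>. norm (f Th0 x y * h (z * ratio x y)) \<le> norm (f Th0 x y * lam Th0)"
    using h z x
    by (intro AE_I2)
       (auto simp: abs_mult density_nonneg lam_nonneg ratio_nonneg admissible_nonneg[OF h]
             intro!: mult_left_mono admissible_le[OF h])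
qed

lemma nn_integral_step:
  assumes "admissible h" "0 \<le> z" "x \<in> space X"
  shows "(\<integral>\<^sup>+ y. ennreal (f Th0 x y * h (z * ratio x y)) \<partial>\<mu>) = ennreal (step_value \<mu> f h z x)"
  unfolding step_value_def
  using step_integrable[OF assms] step_integrand_nonneg[OF assms]
  by (intro nn_integral_eq_integral) (auto intro: AE_I2)

lemma step_nonneg:
  assumes "admissible h" "0 \<le> z" "x \<in> space X"
  shows "0 \<le> step_value \<mu> f h z x"
  unfolding step_value_def using step_integrand_nonneg[OF assms]
  by (intro Bochner_Integration.integral_nonneg) auto

lemma step_le:
  assumes "admissible h" "0 \<le> z" "x \<in> space X"
  shows "step_value \<mu> f h z x \<le> lam Th0"
proof -
  have "step_value \<mu> f h z x \<le> (\<integral> y. f Th0 x y * lam Th0 \<partial>\<mu>)"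
    unfolding step_value_def using assms
    by (intro integral_mono step_integrable[OF assms])
       (auto simp: integrable_density density_nonneg ratio_nonneg
         intro!: mult_left_mono admissible_le[OF assms(1)])
  also have "\<dots> = lam Th0"
    using integral_density[OF assms(3)] by simp
  finally show ?thesis .
qed

lemma step_mono:
  assumes "admissible h" "admissible h'" "\<And>w. 0 \<le> w \<Longrightarrow> h w \<le> h' w" "0 \<le> z" "x \<in> space X"
  shows "step_value \<mu> f h z x \<le> step_value \<mu> f h' z x"
  unfolding step_value_def using assms
  by (intro integral_mono step_integrable[OF assms(1,4,5)] step_integrable[OF assms(2,4,5)])
     (auto simp: density_nonneg ratio_nonneg intro!: mult_left_mono)

text \<open>
  A change of \<open>z\<close> is scaled by the likelihood ratio and weighted by the density under \<open>Th0\<close>;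
  the product of these is at most the density under \<open>Th1\<close>, which integrates to one. Hence
  averaging preserves the Lipschitz constant, whatever the control.
\<close>

lemma step_lipschitz:
  assumes h: "admissible h" and z: "0 \<le> z" and w: "0 \<le> w" and x: "x \<in> space X"
  shows "step_value \<mu> f h z x \<le> step_value \<mu> f h w x + lam Th1 * \<bar>z - w\<bar>"
proof -
  have "step_value \<mu> f h z x
      \<le> (\<integral> y. f Th0 x y * h (w * ratio x y) + f Th1 x y * (lam Th1 * \<bar>z - w\<bar>) \<partial>\<mu>)"
    unfolding step_value_def
  proof (rule integral_mono)
    fix y assume y: "y \<in> space \<mu>"
    have "h (z * ratio x y) \<le> h (w * ratio x y) + lam Th1 * \<bar>z * ratio x y - w * ratio x y\<bar>"
      using z w ratio_nonneg[OF x y] by (intro admissible_lipschitz[OF h] mult_nonneg_nonneg)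
    also have "\<bar>z * ratio x y - w * ratio x y\<bar> = \<bar>z - w\<bar> * ratio x y"
      using ratio_nonneg[OF x y] by (metis abs_mult abs_of_nonneg left_diff_distrib)
    finally have "f Th0 x y * h (z * ratio x y)
        \<le> f Th0 x y * h (w * ratio x y) + (f Th0 x y * ratio x y) * (lam Th1 * \<bar>z - w\<bar>)"
      using mult_left_mono[OF _ density_nonneg[OF x y, of Th0]] by (fastforce simp: algebra_simps)
    also have "(f Th0 x y * ratio x y) * (lam Th1 * \<bar>z - w\<bar>) \<le> f Th1 x y * (lam Th1 * \<bar>z - w\<bar>)"
      using lam_nonneg density_nonneg[OF x y] by (intro mult_right_mono) auto
    finally show "f Th0 x y * h (z * ratio x y)
        \<le> f Th0 x y * h (w * ratio x y) + f Th1 x y * (lam Th1 * \<bar>z - w\<bar>)"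
      by simp
  qed (use step_integrable[OF h z x] step_integrable[OF h w x] integrable_density[OF x] in auto)
  also have "\<dots> = step_value \<mu> f h w x + lam Th1 * \<bar>z - w\<bar>"
    unfolding step_value_def
    using step_integrable[OF h w x] integrable_density[OF x] integral_density[OF x] by simp
  finally show ?thesis .
qed

section \<open>The Bellman equation\<close>

abbreviation "best_step h z \<equiv> INF x\<in>space X. step_value \<mu> f h z x"

lemma best_step_le:
  assumes "admissible h" "0 \<le> z" "x \<in> space X"
  shows "best_step h z \<le> step_value \<mu> f h z x"
  using assms by (intro cINF_lower bdd_belowI2[of _ 0] step_nonneg)

lemma best_step_ge:
  assumes "\<And>x. x \<in> space X \<Longrightarrow> c \<le> step_value \<mu> f h z x"
  shows "c \<le> best_step h z"
  using assms space_nonempty by (intro cINF_greatest)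

lemma best_step_admissible:
  assumes h: "admissible h"
  shows "admissible (best_step h)"
  unfolding admissible_def
proof safe
  fix z :: real assume z: "0 \<le> z"
  show "0 \<le> best_step h z"
    using h z by (intro best_step_ge step_nonneg)
  obtain x where "x \<in> space X"
    using space_nonempty by blast
  then show "best_step h z \<le> lam Th0"
    using best_step_le step_le h z by (meson order_trans)
next
  fix z w :: real assume z: "0 \<le> z" "0 \<le> w"
  have "best_step h z - lam Th1 * \<bar>z - w\<bar> \<le> best_step h w"
  proof (rule best_step_ge)
    fix x assume "x \<in> space X"
    then show "best_step h z - lam Th1 * \<bar>z - w\<bar> \<le> step_value \<mu> f h w x"
      using best_step_le[OF h z(1)] step_lipschitz[OF h z] by fastforce
  qed
  then show "best_step h z \<le> best_step h w + lam Th1 * \<bar>z - w\<bar>"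
    by simp
qed

lemma g_admissible: "admissible (g_fun lam)"
  unfolding admissible_def g_fun_def
proof safe
  fix z w :: real assume z: "0 \<le> z" "0 \<le> w"
  have "lam Th1 * z \<le> lam Th1 * (w + \<bar>z - w\<bar>)"
    using lam_nonneg by (intro mult_left_mono) auto
  moreover have "0 \<le> lam Th1 * \<bar>z - w\<bar>"
    using lam_nonneg by simp
  ultimately show "min (lam Th0) (lam Th1 * z) \<le> min (lam Th0) (lam Th1 * w) + lam Th1 * \<bar>z - w\<bar>"
    by (simp add: distrib_left)
qed (auto simp: lam_nonneg)

lemma min_admissible:
  assumes "admissible h" "admissible h'"
  shows "admissible (\<lambda>z. min (h z) (1 + h' z))"
  unfolding admissible_def
proof (intro conjI allI impI)
  fix z w :: real assume z: "0 \<le> z" "0 \<le> w"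
  show "min (h z) (1 + h' z) \<le> min (h w) (1 + h' w) + lam Th1 * \<bar>z - w\<bar>"
    using admissible_lipschitz[OF assms(1) z] admissible_lipschitz[OF assms(2) z] by linarith
next
  fix z :: real assume z: "0 \<le> z"
  show "0 \<le> min (h z) (1 + h' z)" "min (h z) (1 + h' z) \<le> lam Th0"
    using admissible_nonneg[OF assms(1) z] admissible_nonneg[OF assms(2) z] admissible_le[OF assms(1) z]
    by linarith+
qed

lemma rho_seq_admissible: "admissible (rho_seq X \<mu> f lam k)"
proof (induction k)
  case (Suc k)
  show ?case
    unfolding rho_seq.simps(2) by (rule min_admissible[OF g_admissible best_step_admissible[OF Suc]])
qed (simp add: g_admissible)

lemma rho_seq_Suc_le: "0 \<le> z \<Longrightarrow> rho_seq X \<mu> f lam (Suc k) z \<le> rho_seq X \<mu> f lam k z"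
proof (induction k arbitrary: z)
  case (Suc k)
  have "best_step (rho_seq X \<mu> f lam (Suc k)) z \<le> best_step (rho_seq X \<mu> f lam k) z"
  proof (rule best_step_ge)
    fix x assume x: "x \<in> space X"
    have "best_step (rho_seq X \<mu> f lam (Suc k)) z \<le> step_value \<mu> f (rho_seq X \<mu> f lam (Suc k)) z x"
      by (rule best_step_le[OF rho_seq_admissible Suc.prems x])
    also have "\<dots> \<le> step_value \<mu> f (rho_seq X \<mu> f lam k) z x"
      by (rule step_mono[OF rho_seq_admissible rho_seq_admissible Suc.IH Suc.prems x])
    finally show "best_step (rho_seq X \<mu> f lam (Suc k)) z \<le> step_value \<mu> f (rho_seq X \<mu> f lam k) z x" .
  qed
  then show ?case
    unfolding rho_seq.simps(2)[of X \<mu> f lam "Suc k"] rho_seq.simps(2)[of X \<mu> f lam k] by simp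
qed simp

lemma rho_seq_tendsto:
  assumes "0 \<le> z"
  shows "(\<lambda>k. rho_seq X \<mu> f lam k z) \<longlonglongrightarrow> \<rho> z" and "\<rho> z \<le> rho_seq X \<mu> f lam k z"
proof -
  have dec: "decseq (\<lambda>k. rho_seq X \<mu> f lam k z)"
    by (intro decseq_SucI rho_seq_Suc_le assms)
  obtain l where "(\<lambda>k. rho_seq X \<mu> f lam k z) \<longlonglongrightarrow> l"
    using decseq_convergent[OF dec, of 0] admissible_nonneg[OF rho_seq_admissible assms] by metis
  then show lim: "(\<lambda>k. rho_seq X \<mu> f lam k z) \<longlonglongrightarrow> \<rho> z"
    unfolding rho_def by (simp add: limI)
  show "\<rho> z \<le> rho_seq X \<mu> f lam k z"
    by (rule decseq_ge[OF dec lim])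
qed

lemma rho_admissible: "admissible \<rho>"
  unfolding admissible_def
proof safe
  fix z :: real assume z: "0 \<le> z"
  show "0 \<le> \<rho> z" "\<rho> z \<le> lam Th0"
    using rho_seq_admissible z
    by (auto intro: LIMSEQ_le_const[OF rho_seq_tendsto(1)] LIMSEQ_le_const2[OF rho_seq_tendsto(1)]
        simp: admissible_def)
next
  fix z w :: real assume "0 \<le> z" "0 \<le> w"
  then show "\<rho> z \<le> \<rho> w + lam Th1 * \<bar>z - w\<bar>"
    using rho_seq_admissible
    by (intro LIMSEQ_le[OF rho_seq_tendsto(1) tendsto_add[OF rho_seq_tendsto(1) tendsto_const]])
       (auto simp: admissible_def)
qed

lemma R_admissible: "admissible R"
  using best_step_admissible[OF rho_admissible] by (simp add: R_fun_def[abs_def])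

lemma R_le_step: "0 \<le> z \<Longrightarrow> x \<in> space X \<Longrightarrow> R z \<le> step_value \<mu> f \<rho> z x"
  unfolding R_fun_def by (rule best_step_le[OF rho_admissible])

text \<open>
  Both the limit over \<open>k\<close> and the minimum over controls are infima, so they commute; inside the
  integral the limit passes by dominated convergence.
\<close>

lemma bellman:
  assumes z: "0 \<le> z"
  shows "\<rho> z = min (g_fun lam z) (1 + R z)"
proof (rule antisym)
  have "\<rho> z - 1 \<le> step_value \<mu> f \<rho> z x" if x: "x \<in> space X" for x
  proof -
    have lim: "(\<lambda>k. step_value \<mu> f (rho_seq X \<mu> f lam k) z x) \<longlonglongrightarrow> step_value \<mu> f \<rho> z x"
      unfolding step_value_def
    proof (rule integral_dominated_convergence)
      show "integrable \<mu> (\<lambda>y. f Th0 x y * lam Th0)"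
        using integrable_density[OF x] by simp
      show "AE y in \<mu>. (\<lambda>k. f Th0 x y * rho_seq X \<mu> f lam k (z * ratio x y))
          \<longlonglongrightarrow> f Th0 x y * \<rho> (z * ratio x y)"
        by (intro AE_I2 tendsto_mult_left rho_seq_tendsto(1) mult_nonneg_nonneg z ratio_nonneg x)
      show "AE y in \<mu>. norm (f Th0 x y * rho_seq X \<mu> f lam k (z * ratio x y)) \<le> f Th0 x y * lam Th0" for k
        using z x density_nonneg[OF x]
        by (intro AE_I2)
           (auto simp: abs_mult ratio_nonneg admissible_nonneg[OF rho_seq_admissible]
             intro!: mult_left_mono admissible_le[OF rho_seq_admissible])
    qed (use step_integrable[OF rho_admissible z x] step_integrable[OF rho_seq_admissible z x] in auto)
    have "\<rho> z - 1 \<le> step_value \<mu> f (rho_seq X \<mu> f lam k) z x" for k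
      using rho_seq_tendsto(2)[OF z, of "Suc k"] best_step_le[OF rho_seq_admissible z x, of k] by simp
    then show ?thesis
      by (intro LIMSEQ_le_const[OF lim]) auto
  qed
  then have "\<rho> z - 1 \<le> R z"
    unfolding R_fun_def by (rule best_step_ge)
  then show "\<rho> z \<le> min (g_fun lam z) (1 + R z)"
    using rho_seq_tendsto(2)[OF z, of 0] by simp
next
  have "min (g_fun lam z) (1 + R z) \<le> rho_seq X \<mu> f lam (Suc k) z" for k
  proof -
    have "R z \<le> best_step (rho_seq X \<mu> f lam k) z"
    proof (rule best_step_ge)
      fix x assume x: "x \<in> space X"
      show "R z \<le> step_value \<mu> f (rho_seq X \<mu> f lam k) z x"
        using R_le_step[OF z x]
          step_mono[OF rho_admissible rho_seq_admissible rho_seq_tendsto(2) z x] by (rule order_trans)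
    qed
    then show ?thesis by simp
  qed
  then show "min (g_fun lam z) (1 + R z) \<le> \<rho> z"
    by (intro LIMSEQ_le_const[OF LIMSEQ_Suc[OF rho_seq_tendsto(1)[OF z]]]) auto
qed

text \<open>
  Minimising controls need not depend measurably on \<open>z\<close>. Since all one-step values have the same
  Lipschitz constant in \<open>z\<close>, a control that is optimal at one grid point is nearly optimal in the
  whole grid cell; a selection that is constant on cells is measurable for every
  \<open>\<sigma>\<close>-algebra on the controls.
\<close>

lemma measurable_near_minimiser:
  assumes "\<eta> > 0"
  obtains \<sigma> where "\<sigma> \<in> measurable borel X"
    "\<And>z. 0 \<le> z \<Longrightarrow> step_value \<mu> f \<rho> z (\<sigma> z) \<le> R z + \<eta>"
proof -
  \<comment> \<open>The Lipschitz bound is used twice, once for the one-step value and once for \<open>R\<close>.\<close>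
  define \<delta> where "\<delta> = \<eta> / (2 * lam Th1 + 1)"
  have \<delta>: "\<delta> > 0" "2 * (lam Th1 * \<delta>) \<le> \<eta>"
    using assms lam_nonneg[of Th1] by (auto simp: \<delta>_def field_simps)
  define grid :: "real \<Rightarrow> nat" where "grid z = nat \<lfloor>z / \<delta>\<rfloor>" for z
  have "\<exists>x\<in>space X. \<forall>x'\<in>space X. step_value \<mu> f \<rho> (real j * \<delta>) x \<le> step_value \<mu> f \<rho> (real j * \<delta>) x'"
    for j :: nat
    using well_defined \<delta>(1) by (auto simp: rho_well_defined_def has_min_def)
  then obtain p where p: "\<And>j::nat. p j \<in> space X"
    "\<And>j x'. x' \<in> space X \<Longrightarrow> step_value \<mu> f \<rho> (real j * \<delta>) (p j) \<le> step_value \<mu> f \<rho> (real j * \<delta>) x'"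
    by metis
  show ?thesis
  proof
    have "grid \<in> measurable borel (count_space UNIV)"
      unfolding grid_def by measurable
    moreover have "p \<in> measurable (count_space UNIV) X"
      using p(1) by simp
    ultimately show "(\<lambda>z. p (grid z)) \<in> measurable borel X"
      by (rule measurable_compose)
  next
    fix z :: real assume z: "0 \<le> z"
    define w where "w = real (grid z) * \<delta>"
    have "real (grid z) = of_int \<lfloor>z / \<delta>\<rfloor>"
      using z \<delta>(1) by (simp add: grid_def)
    then have "real (grid z) \<le> z / \<delta>" "z / \<delta> \<le> real (grid z) + 1"
      by linarith+
    then have "w \<le> z" "z \<le> w + \<delta>"
      using \<delta>(1) by (auto simp: w_def field_simps)
    then have close: "lam Th1 * \<bar>z - w\<bar> \<le> lam Th1 * \<delta>"
      using lam_nonneg by (intro mult_left_mono) auto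
    have w: "0 \<le> w"
      using \<delta>(1) by (simp add: w_def)
    have "step_value \<mu> f \<rho> z (p (grid z)) \<le> step_value \<mu> f \<rho> w (p (grid z)) + lam Th1 * \<delta>"
      using step_lipschitz[OF rho_admissible z w p(1)] close by (meson add_left_mono order_trans)
    also have "step_value \<mu> f \<rho> w (p (grid z)) \<le> R w"
      unfolding R_fun_def w_def by (intro best_step_ge p(2))
    also have "R w \<le> R z + lam Th1 * \<delta>"
      using admissible_lipschitz[OF R_admissible w z] close by (simp add: abs_minus_commute)
    finally show "step_value \<mu> f \<rho> z (p (grid z)) \<le> R z + \<eta>"
      using \<delta>(2) by linarith
  qed
qed

end

section \<open>Histories generated by a policy\<close>

lemma controls_cong:
  assumes "\<And>i. i < n \<Longrightarrow> ys i = ys' i"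
  shows "controls \<kappa> ys n = controls \<kappa> ys' n"
  using assms
proof (induction n)
  case (Suc n)
  have "restrict ys {1..n} = restrict ys' {1..n}"
    using Suc.prems by (intro restrict_ext) auto
  then show ?case
    using Suc by simp
qed simp

lemma controls_upd: "n < m \<Longrightarrow> controls \<kappa> (ys(m := y)) n = controls \<kappa> ys n"
  by (rule controls_cong) auto

lemma restrict_upd_outside: "n < (m :: nat) \<Longrightarrow> restrict (ys(m := y)) {1..n} = restrict ys {1..n}"
  by (rule restrict_ext) auto

lemma under_upd: "n < m \<Longrightarrow> under \<kappa> F n (ys(m := y)) = under \<kappa> F n ys"
  by (simp add: under_def controls_upd restrict_upd_outside)

lemma next_control_upd: "n < m \<Longrightarrow> next_control \<kappa> n (ys(m := y)) = next_control \<kappa> n ys"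
  by (simp add: next_control_def controls_upd restrict_upd_outside)

lemma continue_prob_upd: "n < m \<Longrightarrow> continue_prob \<kappa> \<psi> n (ys(m := y)) = continue_prob \<kappa> \<psi> n ys"
  by (simp add: continue_prob_def under_upd)

lemma under_lik_Suc:
  "under \<kappa> (lik f \<theta>) (Suc n) ys
     = under \<kappa> (lik f \<theta>) n ys * f \<theta> (next_control \<kappa> n ys) (ys (Suc n))"
proof -
  have "(\<Prod>i=1..n. f \<theta> (controls \<kappa> ys (Suc n) i) (restrict ys {1..Suc n} i))
      = (\<Prod>i=1..n. f \<theta> (controls \<kappa> ys n i) (restrict ys {1..n} i))"
    by (intro prod.cong) auto
  then show ?thesis
    by (simp add: under_def lik_def next_control_def)
qed

lemma under_lik_ratio_Suc:
  "under \<kappa> (lik_ratio f) (Suc n) ys = under \<kappa> (lik_ratio f) n ys *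
     (f Th1 (next_control \<kappa> n ys) (ys (Suc n)) / f Th0 (next_control \<kappa> n ys) (ys (Suc n)))"
proof -
  have "(\<Prod>i=1..n. f Th1 (controls \<kappa> ys (Suc n) i) (restrict ys {1..Suc n} i)
          / f Th0 (controls \<kappa> ys (Suc n) i) (restrict ys {1..Suc n} i))
      = (\<Prod>i=1..n. f Th1 (controls \<kappa> ys n i) (restrict ys {1..n} i)
          / f Th0 (controls \<kappa> ys n i) (restrict ys {1..n} i))"
    by (intro prod.cong) auto
  then show ?thesis
    by (simp add: under_def lik_ratio_def next_control_def)
qed

lemma under_lik_0: "under \<kappa> (lik f \<theta>) 0 ys = 1"
  and under_lik_ratio_0: "under \<kappa> (lik_ratio f) 0 ys = 1"
  by (simp_all add: under_def lik_def lik_ratio_def)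

lemma continue_prob_0: "continue_prob \<kappa> \<psi> 0 ys = 1"
  and continue_prob_Suc:
    "continue_prob \<kappa> \<psi> (Suc n) ys = continue_prob \<kappa> \<psi> n ys * (1 - under \<kappa> \<psi> (Suc n) ys)"
  by (simp_all add: continue_prob_def)

lemma strategy_policy_measurable:
  "strategy X \<mu> \<kappa> \<psi> \<Longrightarrow> (\<lambda>(xs, ys). \<kappa> (Suc n) xs ys)
     \<in> measurable (hist_space n X \<Otimes>\<^sub>M hist_space n \<mu>) X"
  unfolding strategy_def by (metis diff_Suc_1 le_add1 plus_1_eq_Suc)

lemma restrict_measurable:
  "n \<le> m \<Longrightarrow> (\<lambda>ys. restrict ys {1..n}) \<in> measurable (hist_space m \<mu>) (hist_space n \<mu>)"
  by (rule measurable_restrict_subset) auto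

lemma controls_measurable:
  assumes st: "strategy X \<mu> \<kappa> \<psi>" and "n \<le> m"
  shows "(\<lambda>ys. controls \<kappa> ys n) \<in> measurable (hist_space m \<mu>) (hist_space n X)"
  using \<open>n \<le> m\<close>
proof (induction n)
  case 0
  show ?case
    by (auto simp: space_PiM)
next
  case (Suc n)
  have c: "(\<lambda>ys. controls \<kappa> ys n) \<in> measurable (hist_space m \<mu>) (hist_space n X)"
    using Suc by simp
  have "(\<lambda>ys. \<kappa> (Suc n) (controls \<kappa> ys n) (restrict ys {1..n})) \<in> measurable (hist_space m \<mu>) X"
    using measurable_compose[OF measurable_Pair[OF c restrict_measurable] strategy_policy_measurable[OF st]]
      Suc.prems by simp
  then show ?case
    unfolding controls.simps by (intro measurable_fun_upd[OF _ c]) auto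
qed

lemma under_measurable:
  assumes st: "strategy X \<mu> \<kappa> \<psi>" and "n \<le> m"
    and F: "(\<lambda>(xs, ys). F n xs ys) \<in> measurable (hist_space n X \<Otimes>\<^sub>M hist_space n \<mu>) N"
  shows "under \<kappa> F n \<in> measurable (hist_space m \<mu>) N"
  using measurable_compose[OF measurable_Pair[OF controls_measurable[OF st \<open>n \<le> m\<close>]
        restrict_measurable[OF \<open>n \<le> m\<close>]] F]
  by (simp add: under_def[abs_def])

lemma next_control_measurable:
  assumes st: "strategy X \<mu> \<kappa> \<psi>" and "n \<le> m"
  shows "next_control \<kappa> n \<in> measurable (hist_space m \<mu>) X"
  using measurable_compose[OF measurable_Pair[OF controls_measurable[OF st \<open>n \<le> m\<close>]
        restrict_measurable[OF \<open>n \<le> m\<close>]] strategy_policy_measurable[OF st]]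
  by (simp add: next_control_def[abs_def])

lemma next_control_in_space:
  "strategy X \<mu> \<kappa> \<psi> \<Longrightarrow> ys \<in> space (hist_space n \<mu>) \<Longrightarrow> next_control \<kappa> n ys \<in> space X"
  using measurable_space[OF next_control_measurable] by blast

lemma stop_measurable:
  assumes st: "strategy X \<mu> \<kappa> \<psi>" and "1 \<le> n" "n \<le> m"
  shows "under \<kappa> \<psi> n \<in> borel_measurable (hist_space m \<mu>)"
  using st \<open>1 \<le> n\<close> by (intro under_measurable[OF st \<open>n \<le> m\<close>]) (simp add: strategy_def)

lemma stop_bounds:
  assumes st: "strategy X \<mu> \<kappa> \<psi>" and n: "1 \<le> n" "n \<le> m" and ys: "ys \<in> space (hist_space m \<mu>)"
  shows "0 \<le> under \<kappa> \<psi> n ys" "under \<kappa> \<psi> n ys \<le> 1"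
  using measurable_space[OF controls_measurable[OF st n(2)] ys]
    measurable_space[OF restrict_measurable[OF n(2)] ys] st n(1)
  unfolding strategy_def under_def by blast+

lemma continue_prob_measurable:
  assumes "strategy X \<mu> \<kappa> \<psi>" "n \<le> m"
  shows "continue_prob \<kappa> \<psi> n \<in> borel_measurable (hist_space m \<mu>)"
  unfolding continue_prob_def[abs_def] using assms
  by (intro borel_measurable_prod borel_measurable_diff borel_measurable_const stop_measurable) auto

lemma continue_prob_nonneg:
  assumes "strategy X \<mu> \<kappa> \<psi>" "n \<le> m" "ys \<in> space (hist_space m \<mu>)"
  shows "0 \<le> continue_prob \<kappa> \<psi> n ys"
  unfolding continue_prob_def using stop_bounds[OF assms(1) _ _ assms(3)] assms(2)
  by (intro prod_nonneg) auto

context controlled_test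
begin

lemma lik_measurable:
  "(\<lambda>(xs, ys). lik f \<theta> n xs ys) \<in> borel_measurable (hist_space n X \<Otimes>\<^sub>M hist_space n \<mu>)"
  unfolding lik_def case_prod_beta
  by (intro borel_measurable_prod density_measurable_compose measurable_compose[OF measurable_fst]
      measurable_compose[OF measurable_snd] measurable_component_singleton)

lemma lik_ratio_measurable:
  "(\<lambda>(xs, ys). lik_ratio f n xs ys) \<in> borel_measurable (hist_space n X \<Otimes>\<^sub>M hist_space n \<mu>)"
  unfolding lik_ratio_def case_prod_beta
  by (intro borel_measurable_prod borel_measurable_divide density_measurable_compose
      measurable_compose[OF measurable_fst] measurable_compose[OF measurable_snd]
      measurable_component_singleton)

lemma lik_ratio_nonneg:
  assumes "xs \<in> space (hist_space n X)" "ys \<in> space (hist_space n \<mu>)"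
  shows "0 \<le> lik_ratio f n xs ys"
  unfolding lik_ratio_def using assms
  by (intro prod_nonneg ratio_nonneg) (auto simp: space_PiM)

text \<open>
  Where the density under \<open>Th0\<close> vanishes, both sides are zero, so the convention for the likelihood
  ratio is immaterial.
\<close>

lemma decision_loss_eq:
  assumes "xs \<in> space (hist_space n X)" "ys \<in> space (hist_space n \<mu>)"
  shows "decision_loss f lam n xs ys = lik f Th0 n xs ys * g_fun lam (lik_ratio f n xs ys)"
proof -
  have nonneg: "0 \<le> lik f \<theta> n xs ys" for \<theta>
    unfolding lik_def using assms by (intro prod_nonneg density_nonneg) (auto simp: space_PiM)
  show ?thesis
  proof (cases "lik f Th0 n xs ys = 0")
    case True
    then show ?thesis
      using nonneg[of Th1] lam_nonneg by (simp add: decision_loss_def)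
  next
    case False
    then have "lik f Th1 n xs ys = lik f Th0 n xs ys * lik_ratio f n xs ys"
      unfolding lik_ratio_def prod_dividef lik_def by simp
    then show ?thesis
      using nonneg[of Th0]
      by (simp add: decision_loss_def g_fun_def min_mult_distrib_left mult.commute mult.left_commute)
  qed
qed

end

section \<open>Expectations along a strategy\<close>

text \<open>
  For a fixed strategy all expectations are taken under \<open>Th0\<close>, because \<open>decision_loss_eq\<close> expresses
  the error probability under \<open>Th1\<close> through the likelihood ratio.
\<close>

locale strategy_run = controlled_test X \<mu> f lam
  for X :: "'x measure" and \<mu> :: "'y measure"
    and f :: "hyp \<Rightarrow> 'x \<Rightarrow> 'y \<Rightarrow> real" and lam :: "hyp \<Rightarrow> real" +
  fixes \<kappa> :: "('x, 'y) policy" and \<psi> :: "('x, 'y) stopping"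
  assumes strategy: "strategy X \<mu> \<kappa> \<psi>"
begin

abbreviation "hist n \<equiv> hist_space n \<mu>"
abbreviation "law n \<equiv> response_law \<mu> f Th0 \<kappa> n"
abbreviation "z n ys \<equiv> under \<kappa> (lik_ratio f) n ys"
abbreviation "c n ys \<equiv> continue_prob \<kappa> \<psi> n ys"
abbreviation "next_val n ys \<equiv> step_value \<mu> f \<rho> (z n ys) (next_control \<kappa> n ys)"

lemma in_hist:
  assumes "ys \<in> space (hist m)" "n \<le> m"
  shows "controls \<kappa> ys n \<in> space (hist_space n X)" "restrict ys {1..n} \<in> space (hist n)"
  using measurable_space[OF controls_measurable[OF strategy]] measurable_space[OF restrict_measurable]
    assms by blast+

lemma z_measurable: "n \<le> m \<Longrightarrow> z n \<in> borel_measurable (hist m)"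
  by (rule under_measurable[OF strategy _ lik_ratio_measurable])

lemma z_nonneg: "ys \<in> space (hist m) \<Longrightarrow> n \<le> m \<Longrightarrow> 0 \<le> z n ys"
  unfolding under_def by (intro lik_ratio_nonneg in_hist)

lemma under_lik_measurable: "n \<le> m \<Longrightarrow> under \<kappa> (lik f \<theta>) n \<in> borel_measurable (hist m)"
  by (rule under_measurable[OF strategy _ lik_measurable])

lemma under_lik_nonneg: "ys \<in> space (hist m) \<Longrightarrow> n \<le> m \<Longrightarrow> 0 \<le> under \<kappa> (lik f \<theta>) n ys"
  using in_hist[of ys m n]
  by (auto simp: under_def lik_def space_PiM intro!: prod_nonneg density_nonneg)

lemma next_val_measurable: "next_val n \<in> borel_measurable (hist n)"
proof -
  let ?M = "hist n \<Otimes>\<^sub>M \<mu>"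
  have nc: "(\<lambda>p. next_control \<kappa> n (fst p)) \<in> measurable ?M X"
    by (rule measurable_compose[OF measurable_fst next_control_measurable[OF strategy order_refl]])
  have r: "(\<lambda>p. z n (fst p) * ratio (next_control \<kappa> n (fst p)) (snd p)) \<in> borel_measurable ?M"
    by (intro borel_measurable_times borel_measurable_divide density_measurable_compose nc
        measurable_snd measurable_compose[OF measurable_fst z_measurable] order_refl)
  have "(\<lambda>p. \<rho> (z n (fst p) * ratio (next_control \<kappa> n (fst p)) (snd p))) \<in> borel_measurable ?M"
    using next_control_in_space[OF strategy]
    by (intro admissible_measurable[OF rho_admissible r] mult_nonneg_nonneg ratio_nonneg z_nonneg)
       (auto simp: space_pair_measure)
  then have "(\<lambda>(ys, y). f Th0 (next_control \<kappa> n ys) y * \<rho> (z n ys * ratio (next_control \<kappa> n ys) y))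
      \<in> borel_measurable ?M"
    unfolding case_prod_beta
    by (intro borel_measurable_times density_measurable_compose nc measurable_snd)
  then show ?thesis
    unfolding step_value_def by (rule borel_measurable_lebesgue_integral)
qed

lemma next_val_bounds:
  assumes "ys \<in> space (hist n)"
  shows "0 \<le> next_val n ys" "next_val n ys \<le> lam Th0" "R (z n ys) \<le> next_val n ys"
  using assms z_nonneg[OF assms] next_control_in_space[OF strategy assms]
  by (auto intro: step_nonneg[OF rho_admissible] step_le[OF rho_admissible] R_le_step)

lemma nn_integral_law:
  assumes "h \<in> borel_measurable (hist n)"
  shows "(\<integral>\<^sup>+ ys. h ys \<partial>law n) = (\<integral>\<^sup>+ ys. ennreal (under \<kappa> (lik f Th0) n ys) * h ys \<partial>hist n)"
  unfolding response_law_def using under_lik_measurable[of n n Th0] assms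
  by (intro nn_integral_density) auto

lemma space_law [simp]: "space (law n) = space (hist n)"
  and sets_law [simp, measurable_cong]: "sets (law n) = sets (hist n)"
  by (simp_all add: response_law_def)

text \<open>
  Fubini for the last coordinate: given the first \<open>n\<close> responses, the next one has the density that
  belongs to the control prescribed by the policy. Every conditional expectation below is an instance.
\<close>

lemma nn_integral_law_Suc:
  assumes h: "h \<in> borel_measurable (hist (Suc n))"
  shows "(\<integral>\<^sup>+ ys. h ys \<partial>law (Suc n))
    = (\<integral>\<^sup>+ ys. (\<integral>\<^sup>+ y. ennreal (f Th0 (next_control \<kappa> n ys) y) * h (ys(Suc n := y)) \<partial>\<mu>) \<partial>law n)"
proof -
  interpret P: product_sigma_finite "\<lambda>_::nat. \<mu>"
    by standard
  let ?l = "\<lambda>m ys. ennreal (under \<kappa> (lik f Th0) m ys)"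
  let ?k = "\<lambda>ys y. ennreal (f Th0 (next_control \<kappa> n ys) y) * h (ys(Suc n := y))"
  have ins: "{1..Suc n} = insert (Suc n) {1..n}"
    by auto
  have "(\<lambda>(ys, y). ys(Suc n := y)) \<in> measurable (hist n \<Otimes>\<^sub>M \<mu>) (hist (Suc n))"
    unfolding ins by (rule measurable_add_dim)
  then have upd: "(\<lambda>p. (fst p)(Suc n := snd p)) \<in> measurable (hist n \<Otimes>\<^sub>M \<mu>) (hist (Suc n))"
    by (simp add: case_prod_beta)
  have "(\<lambda>p. f Th0 (next_control \<kappa> n (fst p)) (snd p)) \<in> borel_measurable (hist n \<Otimes>\<^sub>M \<mu>)"
    by (intro density_measurable_compose measurable_snd
        measurable_compose[OF measurable_fst next_control_measurable[OF strategy order_refl]])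
  then have k: "(\<lambda>(ys, y). ?k ys y) \<in> borel_measurable (hist n \<Otimes>\<^sub>M \<mu>)"
    using measurable_compose[OF upd h] by (simp add: case_prod_beta)
  have meas: "(\<lambda>ys. ?l (Suc n) ys * h ys) \<in> borel_measurable (hist (Suc n))"
    by (intro borel_measurable_times_ennreal h measurable_compose[OF under_lik_measurable measurable_ennreal]
        order_refl)
  have "(\<integral>\<^sup>+ ys. h ys \<partial>law (Suc n)) = (\<integral>\<^sup>+ ys. ?l (Suc n) ys * h ys \<partial>hist (Suc n))"
    by (rule nn_integral_law[OF h])
  also have "\<dots> = (\<integral>\<^sup>+ ys. (\<integral>\<^sup>+ y. ?l (Suc n) (ys(Suc n := y)) * h (ys(Suc n := y)) \<partial>\<mu>) \<partial>hist n)"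
    unfolding ins by (rule P.product_nn_integral_insert[OF _ _ meas[unfolded ins]]) auto
  also have "\<dots> = (\<integral>\<^sup>+ ys. ?l n ys * (\<integral>\<^sup>+ y. ?k ys y \<partial>\<mu>) \<partial>hist n)"
  proof (rule nn_integral_cong)
    fix ys assume ys: "ys \<in> space (hist n)"
    have "(\<integral>\<^sup>+ y. ?l (Suc n) (ys(Suc n := y)) * h (ys(Suc n := y)) \<partial>\<mu>) = (\<integral>\<^sup>+ y. ?l n ys * ?k ys y \<partial>\<mu>)"
      using under_lik_nonneg[OF ys order_refl] density_nonneg[OF next_control_in_space[OF strategy ys]]
      by (intro nn_integral_cong)
         (simp add: under_lik_Suc under_upd next_control_upd ennreal_mult mult.assoc)
    also have "\<dots> = ?l n ys * (\<integral>\<^sup>+ y. ?k ys y \<partial>\<mu>)"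
      using measurable_compose[OF measurable_Pair1'[OF ys] k]
      by (intro nn_integral_cmult) simp
    finally show "(\<integral>\<^sup>+ y. ?l (Suc n) (ys(Suc n := y)) * h (ys(Suc n := y)) \<partial>\<mu>)
        = ?l n ys * (\<integral>\<^sup>+ y. ?k ys y \<partial>\<mu>)" .
  qed
  also have "\<dots> = (\<integral>\<^sup>+ ys. (\<integral>\<^sup>+ y. ?k ys y \<partial>\<mu>) \<partial>law n)"
    by (intro nn_integral_law[symmetric] borel_measurable_nn_integral k)
  finally show ?thesis .
qed

lemma nn_integral_law_const: "(\<integral>\<^sup>+ ys. a \<partial>law n) = a"
proof (induction n arbitrary: a)
  case 0
  interpret P: product_sigma_finite "\<lambda>_::nat. \<mu>"
    by standard
  show ?case
    by (subst nn_integral_law) (simp_all add: under_lik_0 space_PiM_empty)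
next
  case (Suc n)
  have "(\<integral>\<^sup>+ ys. a \<partial>law (Suc n))
      = (\<integral>\<^sup>+ ys. (\<integral>\<^sup>+ y. ennreal (f Th0 (next_control \<kappa> n ys) y) * a \<partial>\<mu>) \<partial>law n)"
    by (rule nn_integral_law_Suc) simp
  also have "\<dots> = (\<integral>\<^sup>+ ys. a \<partial>law n)"
  proof (rule nn_integral_cong)
    fix ys assume "ys \<in> space (law n)"
    then have x: "next_control \<kappa> n ys \<in> space X"
      by (simp add: next_control_in_space[OF strategy])
    show "(\<integral>\<^sup>+ y. ennreal (f Th0 (next_control \<kappa> n ys) y) * a \<partial>\<mu>) = a"
      using density_measurable[OF x, of Th0] nn_integral_density_eq_1[OF x, of Th0]
      by (simp add: nn_integral_multc)
  qed
  also have "\<dots> = a"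
    by (rule Suc)
  finally show ?case .
qed

end

section \<open>Decomposition of the cost\<close>

text \<open>
  The two summands are the losses from stopping when continuing is better, and from continuing when
  stopping is better or with an inferior control. Read with \<open>p\<close> the stopping probability and \<open>S\<close> the
  value of the chosen control, their vanishing is exactly the stopping rule together with the
  optimality of the control wherever continuation is possible.
\<close>

lemma deviation_eq_0_iff:
  fixes c p g R S :: real
  assumes "0 \<le> c" "0 \<le> p" "p \<le> 1" "R \<le> S"
  shows "c * (p * (g - min g (1 + R)) + (1 - p) * (1 + S - min g (1 + R))) = 0 \<longleftrightarrow>
    (c > 0 \<longrightarrow> of_bool (g < 1 + R) \<le> p \<and> p \<le> of_bool (g \<le> 1 + R)) \<and>
    (c * (1 - p) > 0 \<longrightarrow> S = R)"
proof (cases "c = 0")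
  case False
  then have c: "c > 0" using assms by simp
  have "p * (g - min g (1 + R)) + (1 - p) * (1 + S - min g (1 + R)) = 0 \<longleftrightarrow>
      p * (g - min g (1 + R)) = 0 \<and> (1 - p) * (1 + S - min g (1 + R)) = 0"
    using assms by (intro add_nonneg_eq_0_iff mult_nonneg_nonneg) auto
  also have "\<dots> \<longleftrightarrow> (p = 0 \<or> g \<le> 1 + R) \<and> (p = 1 \<or> (1 + R \<le> g \<and> S = R))"
    using assms by (auto simp: min_def)
  also have "\<dots> \<longleftrightarrow> of_bool (g < 1 + R) \<le> p \<and> p \<le> of_bool (g \<le> 1 + R) \<and> (p < 1 \<longrightarrow> S = R)"
    using assms by (auto simp: of_bool_def)
  finally show ?thesis
    using c by (simp add: zero_less_mult_iff)
qed simp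

context strategy_run
begin

text \<open>
  Stages are counted from zero, so that \<open>deviation n\<close>, \<open>excess n\<close> and \<open>stage_cost n\<close> belong to the
  decision taken after \<open>Suc n\<close> observations. Following Bellman's equation, \<open>deviation\<close> compares that
  decision with the best one at the same likelihood ratio, on the event that it is reached.
\<close>

definition deviation :: "nat \<Rightarrow> (nat \<Rightarrow> 'y) \<Rightarrow> real" where
  "deviation n ys = c n ys *
     (under \<kappa> \<psi> (Suc n) ys * (g_fun lam (z (Suc n) ys) - \<rho> (z (Suc n) ys)) +
      (1 - under \<kappa> \<psi> (Suc n) ys) * (1 + next_val (Suc n) ys - \<rho> (z (Suc n) ys)))"

definition excess :: "nat \<Rightarrow> ennreal" where
  "excess n = (\<integral>\<^sup>+ ys. ennreal (deviation n ys) \<partial>law (Suc n))"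

definition stage_cost :: "nat \<Rightarrow> ennreal" where
  "stage_cost n = (\<integral>\<^sup>+ ys. ennreal (stop_prob \<kappa> \<psi> (Suc n) ys *
     (real (Suc n) + g_fun lam (z (Suc n) ys))) \<partial>law (Suc n))"

text \<open>
  The total cost, earlier observations included, charged to the runs that continue after \<open>n\<close>
  observations, if one more is taken with the control of the policy and the optimal value \<open>\<rho>\<close> is
  paid afterwards.
\<close>

definition pending :: "nat \<Rightarrow> ennreal" where
  "pending n = (\<integral>\<^sup>+ ys. ennreal (c n ys * (real (Suc n) + next_val n ys)) \<partial>law n)"

definition survival :: "nat \<Rightarrow> ennreal" where
  "survival n = (\<integral>\<^sup>+ ys. ennreal (c n ys) \<partial>law n)"

lemma stop_prob_Suc: "stop_prob \<kappa> \<psi> (Suc n) ys = c n ys * under \<kappa> \<psi> (Suc n) ys"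
  by (simp add: stop_prob_def)

lemma g_z_measurable: "(\<lambda>ys. g_fun lam (z n ys)) \<in> borel_measurable (hist n)"
  by (intro admissible_measurable[OF g_admissible] z_measurable order_refl z_nonneg[OF _ order_refl])

lemma rho_z_measurable: "(\<lambda>ys. \<rho> (z n ys)) \<in> borel_measurable (hist n)"
  by (intro admissible_measurable[OF rho_admissible] z_measurable order_refl z_nonneg[OF _ order_refl])

lemmas run_measurable = g_z_measurable rho_z_measurable next_val_measurable
  continue_prob_measurable[OF strategy] stop_measurable[OF strategy]

lemma stop_prob_measurable: "stop_prob \<kappa> \<psi> (Suc n) \<in> borel_measurable (hist (Suc n))"
  unfolding stop_prob_Suc[abs_def] by (intro borel_measurable_times run_measurable) auto

lemma stop_prob_nonneg: "ys \<in> space (hist (Suc n)) \<Longrightarrow> 0 \<le> stop_prob \<kappa> \<psi> (Suc n) ys"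
  unfolding stop_prob_Suc
  by (intro mult_nonneg_nonneg continue_prob_nonneg[OF strategy] stop_bounds[OF strategy]) auto

lemma g_z_nonneg: "ys \<in> space (hist n) \<Longrightarrow> 0 \<le> g_fun lam (z n ys)"
  by (intro admissible_nonneg[OF g_admissible] z_nonneg[OF _ order_refl])

lemma deviation_measurable: "deviation n \<in> borel_measurable (hist (Suc n))"
  unfolding deviation_def[abs_def]
  by (intro borel_measurable_times borel_measurable_add borel_measurable_diff
      borel_measurable_const run_measurable) auto

lemma deviation_nonneg:
  assumes ys: "ys \<in> space (hist (Suc n))"
  shows "0 \<le> deviation n ys"
  unfolding deviation_def
  using bellman[OF z_nonneg[OF ys order_refl]] next_val_bounds(3)[OF ys] stop_bounds[OF strategy _ order_refl ys]
    continue_prob_nonneg[OF strategy _ ys, of n]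
  by (intro mult_nonneg_nonneg add_nonneg_nonneg) auto

text \<open>
  Conditionally on the first \<open>n\<close> responses the mean of \<open>\<rho>\<close> at the next likelihood ratio is
  \<open>next_val n\<close>; the probability of still continuing depends on the first \<open>n\<close> responses only and
  passes through the inner integral.
\<close>

lemma next_val_mean:
  assumes "0 \<le> a"
  shows "(\<integral>\<^sup>+ ys. ennreal (c n ys * (a + \<rho> (z (Suc n) ys))) \<partial>law (Suc n))
    = (\<integral>\<^sup>+ ys. ennreal (c n ys * (a + next_val n ys)) \<partial>law n)"
proof -
  have "(\<lambda>ys. ennreal (c n ys * (a + \<rho> (z (Suc n) ys)))) \<in> borel_measurable (hist (Suc n))"
    by (intro measurable_compose[OF _ measurable_ennreal] borel_measurable_times borel_measurable_add
        borel_measurable_const run_measurable) auto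
  note nn_integral_law_Suc[OF this]
  also have "(\<integral>\<^sup>+ ys. (\<integral>\<^sup>+ y. ennreal (f Th0 (next_control \<kappa> n ys) y) *
      ennreal (c n (ys(Suc n := y)) * (a + \<rho> (z (Suc n) (ys(Suc n := y))))) \<partial>\<mu>) \<partial>law n)
    = (\<integral>\<^sup>+ ys. ennreal (c n ys * (a + next_val n ys)) \<partial>law n)"
  proof (rule nn_integral_cong)
    fix ys assume "ys \<in> space (law n)"
    then have ys: "ys \<in> space (hist n)" by simp
    let ?x = "next_control \<kappa> n ys"
    let ?v = "\<lambda>y. f Th0 ?x y * \<rho> (z n ys * ratio ?x y)"
    have x: "?x \<in> space X"
      by (rule next_control_in_space[OF strategy ys])
    have z: "0 \<le> z n ys"
      by (rule z_nonneg[OF ys order_refl])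
    have c: "0 \<le> c n ys"
      by (rule continue_prob_nonneg[OF strategy order_refl ys])
    have v: "?v \<in> borel_measurable \<mu>"
      using step_integrable[OF rho_admissible z x] by (rule borel_measurable_integrable)
    have "(\<integral>\<^sup>+ y. ennreal (f Th0 ?x y) *
        ennreal (c n (ys(Suc n := y)) * (a + \<rho> (z (Suc n) (ys(Suc n := y))))) \<partial>\<mu>)
      = (\<integral>\<^sup>+ y. ennreal (c n ys) * (ennreal a * ennreal (f Th0 ?x y) + ennreal (?v y)) \<partial>\<mu>)"
    proof (rule nn_integral_cong)
      fix y assume y: "y \<in> space \<mu>"
      have "0 \<le> \<rho> (z n ys * ratio ?x y)"
        by (intro admissible_nonneg[OF rho_admissible] mult_nonneg_nonneg z ratio_nonneg[OF x y])
      then have "ennreal (f Th0 ?x y) * ennreal (c n ys * (a + \<rho> (z n ys * ratio ?x y)))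
          = ennreal (c n ys) * (ennreal a * ennreal (f Th0 ?x y) + ennreal (?v y))"
        using density_nonneg[OF x y] c assms
        by (simp add: ennreal_mult[symmetric] ennreal_plus[symmetric] algebra_simps del: ennreal_plus)
      then show "ennreal (f Th0 ?x y) *
          ennreal (c n (ys(Suc n := y)) * (a + \<rho> (z (Suc n) (ys(Suc n := y)))))
        = ennreal (c n ys) * (ennreal a * ennreal (f Th0 ?x y) + ennreal (?v y))"
        by (simp add: continue_prob_upd under_lik_ratio_Suc under_upd next_control_upd)
    qed
    also have "\<dots> = ennreal (c n ys) * (ennreal a * (\<integral>\<^sup>+ y. ennreal (f Th0 ?x y) \<partial>\<mu>)
        + (\<integral>\<^sup>+ y. ennreal (?v y) \<partial>\<mu>))"
      using v density_measurable[OF x, of Th0] by (simp add: nn_integral_cmult nn_integral_add)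
    also have "\<dots> = ennreal (c n ys * (a + next_val n ys))"
      using nn_integral_step[OF rho_admissible z x] nn_integral_density_eq_1[OF x, of Th0]
        next_val_bounds(1)[OF ys] c assms
      by (simp add: ennreal_mult[symmetric] ennreal_plus[symmetric] del: ennreal_plus)
    finally show "(\<integral>\<^sup>+ y. ennreal (f Th0 ?x y) *
        ennreal (c n (ys(Suc n := y)) * (a + \<rho> (z (Suc n) (ys(Suc n := y))))) \<partial>\<mu>)
      = ennreal (c n ys * (a + next_val n ys))" .
  qed
  finally show ?thesis .
qed

lemma survival_marginal: "(\<integral>\<^sup>+ ys. ennreal (c n ys) \<partial>law (Suc n)) = survival n"
proof -
  have "(\<lambda>ys. ennreal (c n ys)) \<in> borel_measurable (hist (Suc n))"
    by (intro measurable_compose[OF _ measurable_ennreal] run_measurable) auto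
  note nn_integral_law_Suc[OF this]
  also have "(\<integral>\<^sup>+ ys. (\<integral>\<^sup>+ y. ennreal (f Th0 (next_control \<kappa> n ys) y) * ennreal (c n (ys(Suc n := y))) \<partial>\<mu>) \<partial>law n)
    = survival n"
    unfolding survival_def
  proof (rule nn_integral_cong)
    fix ys assume "ys \<in> space (law n)"
    then have x: "next_control \<kappa> n ys \<in> space X"
      by (simp add: next_control_in_space[OF strategy])
    show "(\<integral>\<^sup>+ y. ennreal (f Th0 (next_control \<kappa> n ys) y) * ennreal (c n (ys(Suc n := y))) \<partial>\<mu>)
        = ennreal (c n ys)"
      using density_measurable[OF x, of Th0] nn_integral_density_eq_1[OF x, of Th0]
      by (simp add: continue_prob_upd nn_integral_multc)
  qed
  finally show ?thesis .
qed

lemma survival_Suc: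
  "(\<integral>\<^sup>+ ys. ennreal (stop_prob \<kappa> \<psi> (Suc n) ys) \<partial>law (Suc n)) + survival (Suc n) = survival n"
proof -
  have "(\<integral>\<^sup>+ ys. ennreal (stop_prob \<kappa> \<psi> (Suc n) ys) \<partial>law (Suc n)) + survival (Suc n)
      = (\<integral>\<^sup>+ ys. ennreal (stop_prob \<kappa> \<psi> (Suc n) ys) + ennreal (c (Suc n) ys) \<partial>law (Suc n))"
    unfolding survival_def
    by (intro nn_integral_add[symmetric] measurable_compose[OF _ measurable_ennreal])
       (use stop_prob_measurable run_measurable(4) in \<open>simp_all add: measurable_cong_sets[OF sets_law refl]\<close>)
  also have "\<dots> = (\<integral>\<^sup>+ ys. ennreal (c n ys) \<partial>law (Suc n))"
  proof (rule nn_integral_cong)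
    fix ys assume "ys \<in> space (law (Suc n))"
    then have "0 \<le> stop_prob \<kappa> \<psi> (Suc n) ys" "0 \<le> c (Suc n) ys"
      by (auto intro: stop_prob_nonneg continue_prob_nonneg[OF strategy order_refl])
    then show "ennreal (stop_prob \<kappa> \<psi> (Suc n) ys) + ennreal (c (Suc n) ys) = ennreal (c n ys)"
      by (simp add: ennreal_plus[symmetric] stop_prob_Suc continue_prob_Suc algebra_simps del: ennreal_plus)
  qed
  finally show ?thesis
    by (simp add: survival_marginal)
qed

text \<open>
  The charge \<open>\<rho>\<close> is split at stage \<open>Suc n\<close> into what is paid by stopping, what remains pending, and
  the loss caused by deviating from Bellman's optimal choice. All four terms are
  nonnegative, so the identity is one between extended reals and can be summed freely.
\<close>

lemma one_stage: "stage_cost n + pending (Suc n) = pending n + excess n"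
proof -
  note meas = measurable_compose[OF _ measurable_ennreal] borel_measurable_times borel_measurable_add
    borel_measurable_const run_measurable stop_prob_measurable deviation_measurable
  let ?L = "law (Suc n)"
  let ?s = "\<lambda>ys. stop_prob \<kappa> \<psi> (Suc n) ys * (real (Suc n) + g_fun lam (z (Suc n) ys))"
  let ?t = "\<lambda>ys. c (Suc n) ys * (real (Suc (Suc n)) + next_val (Suc n) ys)"
  let ?p = "\<lambda>ys. c n ys * (real (Suc n) + \<rho> (z (Suc n) ys))"
  have m: "?s \<in> borel_measurable (hist (Suc n))" "?t \<in> borel_measurable (hist (Suc n))"
    "?p \<in> borel_measurable (hist (Suc n))"
    by (intro meas; simp)+
  have "stage_cost n + pending (Suc n) = (\<integral>\<^sup>+ ys. ennreal (?s ys) + ennreal (?t ys) \<partial>?L)"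
    unfolding stage_cost_def pending_def using m
    by (intro nn_integral_add[symmetric]) (simp_all add: measurable_cong_sets[OF sets_law refl])
  also have "\<dots> = (\<integral>\<^sup>+ ys. ennreal (?p ys) + ennreal (deviation n ys) \<partial>?L)"
  proof (rule nn_integral_cong)
    fix ys assume "ys \<in> space ?L"
    then have ys: "ys \<in> space (hist (Suc n))" by simp
    have "0 \<le> ?s ys"
      using stop_prob_nonneg[OF ys] g_z_nonneg[OF ys] by simp
    moreover have "0 \<le> ?t ys"
      using continue_prob_nonneg[OF strategy order_refl ys] next_val_bounds(1)[OF ys] by simp
    moreover have "0 \<le> ?p ys"
      using continue_prob_nonneg[OF strategy _ ys, of n]
        admissible_nonneg[OF rho_admissible z_nonneg[OF ys order_refl]] by simp
    moreover have "?s ys + ?t ys = ?p ys + deviation n ys"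
      by (simp add: stop_prob_Suc continue_prob_Suc deviation_def algebra_simps)
    ultimately show "ennreal (?s ys) + ennreal (?t ys) = ennreal (?p ys) + ennreal (deviation n ys)"
      using deviation_nonneg[OF ys] by (metis ennreal_plus)
  qed
  also have "\<dots> = (\<integral>\<^sup>+ ys. ennreal (?p ys) \<partial>?L) + excess n"
    unfolding excess_def using m deviation_measurable
    by (intro nn_integral_add) (simp_all add: measurable_cong_sets[OF sets_law refl])
  also have "(\<integral>\<^sup>+ ys. ennreal (?p ys) \<partial>?L) = pending n"
    unfolding pending_def by (rule next_val_mean) simp
  finally show ?thesis .
qed

lemma telescope: "(\<Sum>n<N. stage_cost n) + pending N = pending 0 + (\<Sum>n<N. excess n)"
proof (induction N)
  case (Suc N)
  have "(\<Sum>n<Suc N. stage_cost n) + pending (Suc N) = ((\<Sum>n<N. stage_cost n) + pending N) + excess N"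
    using one_stage[of N] by (simp add: add.assoc)
  then show ?case
    using Suc by (simp add: add.assoc)
qed simp

lemma risk_eq: "risk \<mu> f lam \<kappa> \<psi> = (\<Sum>n. stage_cost n)"
  unfolding risk_def Let_def
proof (rule suminf_cong)
  fix n
  have "(\<lambda>ys. ennreal (stop_prob \<kappa> \<psi> (Suc n) ys * (real (Suc n) + g_fun lam (z (Suc n) ys))))
      \<in> borel_measurable (hist (Suc n))"
    by (intro measurable_compose[OF _ measurable_ennreal] borel_measurable_times borel_measurable_add
        borel_measurable_const run_measurable stop_prob_measurable)
  note nn_integral_law[OF this]
  also have "(\<integral>\<^sup>+ ys. ennreal (under \<kappa> (lik f Th0) (Suc n) ys) *
        ennreal (stop_prob \<kappa> \<psi> (Suc n) ys * (real (Suc n) + g_fun lam (z (Suc n) ys))) \<partial>hist (Suc n))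
    = (\<integral>\<^sup>+ ys. ennreal (stop_prob \<kappa> \<psi> (Suc n) ys * (real (Suc n) * under \<kappa> (lik f Th0) (Suc n) ys
        + under \<kappa> (decision_loss f lam) (Suc n) ys)) \<partial>hist (Suc n))"
  proof (rule nn_integral_cong)
    fix ys assume ys: "ys \<in> space (hist (Suc n))"
    have "under \<kappa> (decision_loss f lam) (Suc n) ys
        = under \<kappa> (lik f Th0) (Suc n) ys * g_fun lam (z (Suc n) ys)"
      unfolding under_def by (intro decision_loss_eq in_hist[OF ys order_refl])
    then show "ennreal (under \<kappa> (lik f Th0) (Suc n) ys) *
        ennreal (stop_prob \<kappa> \<psi> (Suc n) ys * (real (Suc n) + g_fun lam (z (Suc n) ys)))
      = ennreal (stop_prob \<kappa> \<psi> (Suc n) ys * (real (Suc n) * under \<kappa> (lik f Th0) (Suc n) ys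
        + under \<kappa> (decision_loss f lam) (Suc n) ys))"
      using stop_prob_nonneg[OF ys] under_lik_nonneg[OF ys order_refl] g_z_nonneg[OF ys]
      by (simp add: ennreal_mult[symmetric] algebra_simps)
  qed
  finally show "(\<integral>\<^sup>+ ys. ennreal (stop_prob \<kappa> \<psi> (Suc n) ys * (real (Suc n) * under \<kappa> (lik f Th0) (Suc n) ys
        + under \<kappa> (decision_loss f lam) (Suc n) ys)) \<partial>hist (Suc n)) = stage_cost n"
    unfolding stage_cost_def by simp
qed

lemma terminating_iff: "(\<kappa>, \<psi>) \<in> terminating X \<mu> f \<longleftrightarrow> survival \<longlonglongrightarrow> 0"
  using strategy by (simp add: terminating_def survival_def[abs_def])

lemma pending_0: "pending 0 = ennreal (1 + step_value \<mu> f \<rho> 1 (first_control \<kappa>))"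
proof -
  have "next_val 0 ys = step_value \<mu> f \<rho> 1 (first_control \<kappa>)" for ys
    by (simp add: under_lik_ratio_0 next_control_def first_control_def restrict_def)
  then show ?thesis
    by (simp add: pending_def continue_prob_0 nn_integral_law_const del: nn_integral_const)
qed

lemma first_control_in_space: "first_control \<kappa> \<in> space X"
  using next_control_in_space[OF strategy, of "\<lambda>_. undefined" 0]
  by (simp add: next_control_def first_control_def space_PiM restrict_def)

lemma survival_le_pending: "ennreal (real (Suc n)) * survival n \<le> pending n"
proof -
  have "ennreal (real (Suc n)) * survival n = (\<integral>\<^sup>+ ys. ennreal (real (Suc n)) * ennreal (c n ys) \<partial>law n)"
    unfolding survival_def
    by (intro nn_integral_cmult[symmetric] measurable_compose[OF _ measurable_ennreal])
       (use run_measurable(4) in \<open>simp add: measurable_cong_sets[OF sets_law refl]\<close>)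
  also have "\<dots> \<le> pending n"
    unfolding pending_def
  proof (rule nn_integral_mono)
    fix ys assume "ys \<in> space (law n)"
    then have ys: "ys \<in> space (hist n)" by simp
    have "c n ys * real (Suc n) \<le> c n ys * (real (Suc n) + next_val n ys)"
      using continue_prob_nonneg[OF strategy order_refl ys] next_val_bounds(1)[OF ys]
      by (intro mult_left_mono) auto
    then show "ennreal (real (Suc n)) * ennreal (c n ys) \<le> ennreal (c n ys * (real (Suc n) + next_val n ys))"
      using continue_prob_nonneg[OF strategy order_refl ys]
      by (subst ennreal_mult[symmetric]) (auto intro: ennreal_leI simp: mult.commute)
  qed
  finally show ?thesis .
qed

text \<open>
  Bounding the value by \<open>lam Th0\<close> shows that \<open>pending\<close> exceeds \<open>n * survival n\<close> by a bounded multiple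
  of the survival probability only, which is negligible for a terminating strategy.
\<close>

lemma pending_le_survival: "pending n \<le> ennreal (real n) * survival n + ennreal (1 + lam Th0) * survival n"
proof -
  have "pending n \<le> (\<integral>\<^sup>+ ys. ennreal (real n + (1 + lam Th0)) * ennreal (c n ys) \<partial>law n)"
    unfolding pending_def
  proof (rule nn_integral_mono)
    fix ys assume "ys \<in> space (law n)"
    then have ys: "ys \<in> space (hist n)" by simp
    have "c n ys * (real (Suc n) + next_val n ys) \<le> c n ys * (real n + (1 + lam Th0))"
      using continue_prob_nonneg[OF strategy order_refl ys] next_val_bounds(2)[OF ys]
      by (intro mult_left_mono) auto
    then show "ennreal (c n ys * (real (Suc n) + next_val n ys)) \<le> ennreal (real n + (1 + lam Th0)) * ennreal (c n ys)"
      using continue_prob_nonneg[OF strategy order_refl ys] lam_nonneg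
      by (subst ennreal_mult[symmetric]) (auto intro: ennreal_leI simp: mult.commute add_nonneg_nonneg)
  qed
  also have "\<dots> = ennreal (real n + (1 + lam Th0)) * survival n"
    unfolding survival_def
    by (intro nn_integral_cmult measurable_compose[OF _ measurable_ennreal])
       (use run_measurable(4) in \<open>simp add: measurable_cong_sets[OF sets_law refl]\<close>)
  also have "\<dots> = ennreal (real n) * survival n + ennreal (1 + lam Th0) * survival n"
    using lam_nonneg by (subst ennreal_plus) (auto simp: distrib_right)
  finally show ?thesis .
qed

text \<open>
  Mass that stops at stage \<open>Suc n\<close> has already paid for \<open>Suc n\<close> observations.
\<close>

lemma survival_le_stage_cost:
  assumes a: "0 \<le> a" "a \<le> real (Suc n)"
  shows "ennreal a * survival n \<le> stage_cost n + ennreal a * survival (Suc n)"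
proof -
  let ?q = "\<integral>\<^sup>+ ys. ennreal (stop_prob \<kappa> \<psi> (Suc n) ys) \<partial>law (Suc n)"
  have "ennreal a * ?q = (\<integral>\<^sup>+ ys. ennreal a * ennreal (stop_prob \<kappa> \<psi> (Suc n) ys) \<partial>law (Suc n))"
    by (intro nn_integral_cmult[symmetric] measurable_compose[OF _ measurable_ennreal])
       (use stop_prob_measurable in \<open>simp add: measurable_cong_sets[OF sets_law refl]\<close>)
  also have "\<dots> \<le> stage_cost n"
    unfolding stage_cost_def
  proof (rule nn_integral_mono)
    fix ys assume "ys \<in> space (law (Suc n))"
    then have ys: "ys \<in> space (hist (Suc n))" by simp
    have "stop_prob \<kappa> \<psi> (Suc n) ys * a
        \<le> stop_prob \<kappa> \<psi> (Suc n) ys * (real (Suc n) + g_fun lam (z (Suc n) ys))"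
      using stop_prob_nonneg[OF ys] g_z_nonneg[OF ys] a by (intro mult_left_mono) auto
    then show "ennreal a * ennreal (stop_prob \<kappa> \<psi> (Suc n) ys)
        \<le> ennreal (stop_prob \<kappa> \<psi> (Suc n) ys * (real (Suc n) + g_fun lam (z (Suc n) ys)))"
      using stop_prob_nonneg[OF ys] a
      by (subst ennreal_mult[symmetric]) (auto intro: ennreal_leI simp: mult.commute)
  qed
  finally show ?thesis
    unfolding survival_Suc[of n, symmetric] distrib_left by (rule add_right_mono)
qed

text \<open>
  All mass that survives \<open>N\<close> stages of a terminating strategy eventually stops, and pays for more than
  \<open>N\<close> observations when it does. So the observation costs pending at \<open>N\<close> are covered by the later
  part of the risk.
\<close>

lemma survival_le_risk:
  assumes "survival \<longlonglongrightarrow> 0"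
  shows "(\<Sum>n<N. stage_cost n) + ennreal (real N) * survival N \<le> risk \<mu> f lam \<kappa> \<psi>"
proof -
  have "(\<Sum>n<N. stage_cost n) + ennreal (real N) * survival N
      \<le> risk \<mu> f lam \<kappa> \<psi> + ennreal (real N) * survival (N + m)" for m
  proof -
    have "(\<Sum>n<N. stage_cost n) + ennreal (real N) * survival N
        \<le> (\<Sum>n<N + m. stage_cost n) + ennreal (real N) * survival (N + m)"
    proof (induction m)
      case (Suc m)
      have "ennreal (real N) * survival (N + m)
          \<le> stage_cost (N + m) + ennreal (real N) * survival (Suc (N + m))"
        by (rule survival_le_stage_cost) auto
      then have "(\<Sum>n<N + m. stage_cost n) + ennreal (real N) * survival (N + m)
          \<le> (\<Sum>n<N + Suc m. stage_cost n) + ennreal (real N) * survival (N + Suc m)"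
        by (simp add: add.assoc add_left_mono)
      with Suc show ?case
        by (rule order_trans)
    qed simp
    also have "(\<Sum>n<N + m. stage_cost n) \<le> risk \<mu> f lam \<kappa> \<psi>"
      unfolding risk_eq by (intro sum_le_suminf) auto
    finally show ?thesis
      by (auto intro: add_right_mono)
  qed
  moreover have "(\<lambda>m. survival (N + m)) \<longlonglongrightarrow> 0"
    using LIMSEQ_ignore_initial_segment[OF assms, of N] by (simp add: add.commute)
  then have "(\<lambda>m. risk \<mu> f lam \<kappa> \<psi> + ennreal (real N) * survival (N + m))
      \<longlonglongrightarrow> risk \<mu> f lam \<kappa> \<psi> + ennreal (real N) * 0"
    by (intro tendsto_add tendsto_const ennreal_tendsto_cmult) auto
  ultimately show ?thesis
    by (intro LIMSEQ_le_const[where X = "\<lambda>m. risk \<mu> f lam \<kappa> \<psi> + ennreal (real N) * survival (N + m)"]) auto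
qed


section \<open>Risk as first step plus excess\<close>

text \<open>
  Together with \<open>risk_ge\<close> this identifies the risk of a terminating strategy as the cost of its first
  control plus the accumulated losses of its deviations. In the present direction the pending cost
  is simply dropped; in the other it has to be compared with the tail of the risk.
\<close>

lemma risk_le: "risk \<mu> f lam \<kappa> \<psi> \<le> pending 0 + (\<Sum>n. excess n)"
  unfolding risk_eq
proof (rule suminf_le_const)
  fix N
  have "(\<Sum>n<N. stage_cost n) \<le> (\<Sum>n<N. stage_cost n) + pending N"
    by simp
  also have "\<dots> \<le> pending 0 + (\<Sum>n. excess n)"
    unfolding telescope by (intro add_left_mono sum_le_suminf) auto
  finally show "(\<Sum>n<N. stage_cost n) \<le> pending 0 + (\<Sum>n. excess n)" .
qed simp

text \<open>
  The strategy pays for \<open>Suc n\<close> observations on the event of surviving \<open>n\<close> stages, so bounded cost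
  forces the survival probability to decay like \<open>1 / n\<close>.
\<close>

lemma survival_tendsto_0:
  assumes "pending 0 + (\<Sum>n. excess n) \<le> ennreal b" "0 \<le> b"
  shows "survival \<longlonglongrightarrow> 0"
proof (rule tendsto_sandwich[OF _ _ tendsto_const])
  have "survival n \<le> ennreal (b / real (Suc n))" for n
  proof -
    have "ennreal (real (Suc n)) * survival n \<le> pending n"
      by (rule survival_le_pending)
    also have "\<dots> \<le> (\<Sum>i<n. stage_cost i) + pending n"
      by simp
    also have "\<dots> \<le> pending 0 + (\<Sum>n. excess n)"
      unfolding telescope by (intro add_left_mono sum_le_suminf) auto
    finally have "ennreal (real (Suc n)) * survival n \<le> ennreal b"
      using assms(1) by (rule order_trans)
    then have "ennreal (1 / real (Suc n)) * (ennreal (real (Suc n)) * survival n)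
        \<le> ennreal (1 / real (Suc n)) * ennreal b"
      by (rule mult_left_mono) simp
    moreover have "ennreal (1 / real (Suc n)) * ennreal (real (Suc n)) = 1"
      by (subst ennreal_mult[symmetric]) auto
    moreover have "ennreal (1 / real (Suc n)) * ennreal b = ennreal (b / real (Suc n))"
      using assms(2) by (subst ennreal_mult[symmetric]) auto
    ultimately show ?thesis
      by (simp add: mult.assoc[symmetric])
  qed
  then show "\<forall>\<^sub>F n in sequentially. survival n \<le> ennreal (b / real (Suc n))"
    by simp
  have "(\<lambda>n. b / real (Suc n)) \<longlonglongrightarrow> 0"
    using LIMSEQ_Suc[OF lim_const_over_n[of b]] by simp
  then show "(\<lambda>n. ennreal (b / real (Suc n))) \<longlonglongrightarrow> 0"
    by (metis ennreal_0 tendsto_ennrealI)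
qed simp

lemma risk_ge:
  assumes "(\<kappa>, \<psi>) \<in> terminating X \<mu> f"
  shows "pending 0 + (\<Sum>n. excess n) \<le> risk \<mu> f lam \<kappa> \<psi>"
proof (rule LIMSEQ_le)
  have lim: "survival \<longlonglongrightarrow> 0"
    using assms by (simp add: terminating_iff)
  show "(\<lambda>N. pending 0 + (\<Sum>n<N. excess n)) \<longlonglongrightarrow> pending 0 + (\<Sum>n. excess n)"
    by (intro tendsto_add tendsto_const summable_LIMSEQ) simp
  have "(\<lambda>N. risk \<mu> f lam \<kappa> \<psi> + ennreal (1 + lam Th0) * survival N)
      \<longlonglongrightarrow> risk \<mu> f lam \<kappa> \<psi> + ennreal (1 + lam Th0) * 0"
    by (intro tendsto_add tendsto_const ennreal_tendsto_cmult lim) simp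
  then show "(\<lambda>N. risk \<mu> f lam \<kappa> \<psi> + ennreal (1 + lam Th0) * survival N) \<longlonglongrightarrow> risk \<mu> f lam \<kappa> \<psi>"
    by simp
  have "pending 0 + (\<Sum>n<N. excess n) \<le> risk \<mu> f lam \<kappa> \<psi> + ennreal (1 + lam Th0) * survival N" for N
  proof -
    have "pending 0 + (\<Sum>n<N. excess n)
        \<le> (\<Sum>n<N. stage_cost n) + (ennreal (real N) * survival N + ennreal (1 + lam Th0) * survival N)"
      unfolding telescope[symmetric] by (intro add_left_mono pending_le_survival)
    also have "\<dots> = ((\<Sum>n<N. stage_cost n) + ennreal (real N) * survival N) + ennreal (1 + lam Th0) * survival N"
      by (simp add: add.assoc)
    also have "\<dots> \<le> risk \<mu> f lam \<kappa> \<psi> + ennreal (1 + lam Th0) * survival N"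
      by (intro add_right_mono survival_le_risk lim)
    finally show ?thesis .
  qed
  then show "\<exists>N0. \<forall>N\<ge>N0. pending 0 + (\<Sum>n<N. excess n)
      \<le> risk \<mu> f lam \<kappa> \<psi> + ennreal (1 + lam Th0) * survival N"
    by blast
qed

lemma excess_eq_0_iff:
  "excess n = 0 \<longleftrightarrow> stopping_condition X \<mu> f lam \<kappa> \<psi> (Suc n) \<and> control_condition X \<mu> f lam \<kappa> \<psi> (Suc n)"
proof -
  let ?cond = "\<lambda>ys. (c n ys > 0 \<longrightarrow>
        of_bool (g_fun lam (z (Suc n) ys) < 1 + R (z (Suc n) ys)) \<le> under \<kappa> \<psi> (Suc n) ys \<and>
        under \<kappa> \<psi> (Suc n) ys \<le> of_bool (g_fun lam (z (Suc n) ys) \<le> 1 + R (z (Suc n) ys))) \<and>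
      (c (Suc n) ys > 0 \<longrightarrow> next_val (Suc n) ys = R (z (Suc n) ys))"
  have "excess n = 0 \<longleftrightarrow> (AE ys in law (Suc n). ennreal (deviation n ys) = 0)"
    unfolding excess_def using deviation_measurable
    by (intro nn_integral_0_iff_AE measurable_compose[OF _ measurable_ennreal])
       (simp add: measurable_cong_sets[OF sets_law refl])
  also have "\<dots> \<longleftrightarrow> (AE ys in law (Suc n). ?cond ys)"
  proof (rule AE_cong)
    fix ys assume "ys \<in> space (law (Suc n))"
    then have ys: "ys \<in> space (hist (Suc n))" by simp
    have "ennreal (deviation n ys) = 0 \<longleftrightarrow> deviation n ys = 0"
      using deviation_nonneg[OF ys] by (simp add: ennreal_eq_0_iff)
    also have "\<dots> \<longleftrightarrow> ?cond ys"
      unfolding deviation_def bellman[OF z_nonneg[OF ys order_refl]] continue_prob_Suc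
      using stop_bounds[OF strategy _ order_refl ys] continue_prob_nonneg[OF strategy _ ys, of n]
        next_val_bounds(3)[OF ys]
      by (intro deviation_eq_0_iff) auto
    finally show "ennreal (deviation n ys) = 0 \<longleftrightarrow> ?cond ys" .
  qed
  finally show ?thesis
    by (simp add: stopping_condition_def control_condition_def Let_def)
qed

lemma bound_le_pending: "ennreal (1 + R 1) \<le> pending 0"
  unfolding pending_0 by (intro ennreal_leI add_left_mono R_le_step first_control_in_space) auto

lemma attains_bound_iff:
  "pending 0 + (\<Sum>n. excess n) = ennreal (1 + R 1) \<longleftrightarrow>
    (\<forall>k\<ge>1. stopping_condition X \<mu> f lam \<kappa> \<psi> k \<and> control_condition X \<mu> f lam \<kappa> \<psi> k) \<and>
    first_control_condition X \<mu> f lam \<kappa>"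
proof -
  let ?v = "ennreal (1 + R 1)"
  have R_nonneg: "0 \<le> R 1"
    by (rule admissible_nonneg[OF R_admissible]) simp
  have "pending 0 + (\<Sum>n. excess n) = ?v \<longleftrightarrow> pending 0 = ?v \<and> (\<Sum>n. excess n) = 0"
  proof
    assume eq: "pending 0 + (\<Sum>n. excess n) = ?v"
    have p: "pending 0 = ?v"
      using bound_le_pending eq by (metis antisym le_iff_add)
    with eq have "?v + (\<Sum>n. excess n) = ?v + 0"
      by simp
    then show "pending 0 = ?v \<and> (\<Sum>n. excess n) = 0"
      using p by (simp only: ennreal_add_left_cancel) simp
  qed simp
  also have "pending 0 = ?v \<longleftrightarrow> first_control_condition X \<mu> f lam \<kappa>"
  proof -
    have "0 \<le> step_value \<mu> f \<rho> 1 (first_control \<kappa>)"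
      by (intro step_nonneg[OF rho_admissible] first_control_in_space) auto
    then show ?thesis
      using R_nonneg by (simp add: pending_0 first_control_condition_def del: ennreal_plus)
  qed
  also have "(\<Sum>n. excess n) = 0 \<longleftrightarrow> (\<forall>n. excess n = 0)"
    by (intro suminf_eq_zero_iff) auto
  also have "\<dots> \<longleftrightarrow> (\<forall>k\<ge>1. stopping_condition X \<mu> f lam \<kappa> \<psi> k \<and> control_condition X \<mu> f lam \<kappa> \<psi> k)"
    unfolding excess_eq_0_iff by (metis Suc_le_D One_nat_def le_add1 plus_1_eq_Suc)
  finally show ?thesis by blast
qed

lemma continue_prob_le_1:
  assumes "n \<le> m" "ys \<in> space (hist m)"
  shows "c n ys \<le> 1"
  unfolding continue_prob_def using stop_bounds[OF strategy _ _ assms(2)] assms(1)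
  by (intro prod_le_1) auto

end

section \<open>The optimal risk\<close>

context controlled_test
begin

text \<open>
  Stop exactly when \<open>g \<le> 1 + R\<close>, and otherwise apply a measurable nearly minimising control, with
  tolerances that sum to \<open>e\<close> over the stages. Deviations then come from the controls alone.
\<close>

lemma near_optimal_strategy:
  assumes e: "0 < e"
  obtains \<kappa> \<psi> where "(\<kappa>, \<psi>) \<in> terminating X \<mu> f"
    "risk \<mu> f lam \<kappa> \<psi> \<le> ennreal (1 + R 1) + ennreal e"
proof -
  define \<eta> :: "nat \<Rightarrow> real" where "\<eta> n = e * (1 / 2) ^ Suc n" for n
  have \<eta>: "\<eta> n > 0" for n
    using e by (simp add: \<eta>_def)
  have "\<exists>\<sigma>. \<sigma> \<in> measurable borel X \<and> (\<forall>z\<ge>0. step_value \<mu> f \<rho> z (\<sigma> z) \<le> R z + \<eta> n)" for n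
    using measurable_near_minimiser[OF \<eta>[of n]] by metis
  then obtain \<sigma> where \<sigma>: "\<And>n. \<sigma> n \<in> measurable borel X"
    "\<And>n z. 0 \<le> z \<Longrightarrow> step_value \<mu> f \<rho> z (\<sigma> n z) \<le> R z + \<eta> n"
    by metis
  define \<kappa> :: "('x, 'y) policy" where "\<kappa> n xs ys = \<sigma> (n - 1) (lik_ratio f (n - 1) xs ys)" for n xs ys
  define \<psi> :: "('x, 'y) stopping" where
    "\<psi> n xs ys = (if g_fun lam (lik_ratio f n xs ys) \<le> 1 + R (lik_ratio f n xs ys) then 1 else 0)"
    for n xs ys
  have "strategy X \<mu> \<kappa> \<psi>"
    unfolding strategy_def
  proof (intro conjI allI impI ballI)
    fix n :: nat
    show "(\<lambda>(xs, ys). \<kappa> n xs ys) \<in> measurable (hist_space (n - 1) X \<Otimes>\<^sub>M hist_space (n - 1) \<mu>) X"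
      using measurable_compose[OF lik_ratio_measurable \<sigma>(1)] by (simp add: \<kappa>_def case_prod_beta)
    let ?M = "hist_space n X \<Otimes>\<^sub>M hist_space n \<mu>"
    have l: "(\<lambda>p. lik_ratio f n (fst p) (snd p)) \<in> borel_measurable ?M"
      using lik_ratio_measurable by (simp add: case_prod_beta)
    have l0: "0 \<le> lik_ratio f n (fst p) (snd p)" if "p \<in> space ?M" for p
      using that by (intro lik_ratio_nonneg) (auto simp: space_pair_measure)
    have g: "(\<lambda>p. g_fun lam (lik_ratio f n (fst p) (snd p))) \<in> borel_measurable ?M"
      by (rule admissible_measurable[OF g_admissible l l0])
    have R: "(\<lambda>p. R (lik_ratio f n (fst p) (snd p))) \<in> borel_measurable ?M"
      by (rule admissible_measurable[OF R_admissible l l0])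
    show "(\<lambda>(xs, ys). \<psi> n xs ys) \<in> borel_measurable ?M"
      unfolding \<psi>_def case_prod_beta
      by (intro measurable_If measurable_const borel_measurable_le borel_measurable_add
          borel_measurable_const g R) auto
  qed (simp_all add: \<psi>_def)
  then interpret strategy_run X \<mu> f lam \<kappa> \<psi>
    by unfold_locales
  have next_\<kappa>: "next_control \<kappa> n ys = \<sigma> n (z n ys)" for n ys
    by (simp add: next_control_def \<kappa>_def under_def)
  have gap: "next_val n ys \<le> R (z n ys) + \<eta> n" if "ys \<in> space (hist n)" for n ys
    unfolding next_\<kappa> by (intro \<sigma>(2) z_nonneg[OF that order_refl])
  have "pending 0 \<le> ennreal (1 + R 1) + ennreal (e / 2)"
  proof -
    have "step_value \<mu> f \<rho> 1 (first_control \<kappa>) \<le> R 1 + \<eta> 0"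
      using \<sigma>(2)[of 1 0] by (simp add: first_control_def \<kappa>_def lik_ratio_def)
    then show ?thesis
      using e admissible_nonneg[OF R_admissible, of 1] unfolding pending_0
      by (subst ennreal_plus[symmetric]) (auto simp: \<eta>_def intro!: ennreal_leI simp del: ennreal_plus)
  qed
  moreover have "(\<Sum>n. excess n) \<le> ennreal (e / 2)"
  proof -
    have "excess n \<le> ennreal (\<eta> (Suc n))" for n
    proof -
      have "excess n \<le> (\<integral>\<^sup>+ ys. ennreal (\<eta> (Suc n)) \<partial>law (Suc n))"
        unfolding excess_def
      proof (intro nn_integral_mono ennreal_leI)
        fix ys assume "ys \<in> space (law (Suc n))"
        then have ys: "ys \<in> space (hist (Suc n))" by simp
        let ?g = "g_fun lam (z (Suc n) ys)" and ?R = "R (z (Suc n) ys)"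
        let ?d = "under \<kappa> \<psi> (Suc n) ys * (?g - \<rho> (z (Suc n) ys)) +
          (1 - under \<kappa> \<psi> (Suc n) ys) * (1 + next_val (Suc n) ys - \<rho> (z (Suc n) ys))"
        have "under \<kappa> \<psi> (Suc n) ys = (if ?g \<le> 1 + ?R then 1 else 0)"
          by (simp add: under_def \<psi>_def)
        then have d: "?d \<le> \<eta> (Suc n)"
          using gap[OF ys] \<eta>[of "Suc n"] unfolding bellman[OF z_nonneg[OF ys order_refl]]
          by (auto simp: min_def)
        have c: "0 \<le> c n ys" "c n ys \<le> 1"
          using continue_prob_nonneg[OF strategy _ ys] continue_prob_le_1[OF _ ys] by auto
        have "c n ys * ?d \<le> c n ys * \<eta> (Suc n)"
          by (rule mult_left_mono[OF d c(1)])
        also have "\<dots> \<le> 1 * \<eta> (Suc n)"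
          using c(2) \<eta>[of "Suc n"] by (intro mult_right_mono) auto
        finally show "deviation n ys \<le> \<eta> (Suc n)"
          by (simp add: deviation_def)
      qed
      then show ?thesis
        by (simp add: nn_integral_law_const del: nn_integral_const)
    qed
    then have "(\<Sum>n. excess n) \<le> (\<Sum>n. ennreal (\<eta> (Suc n)))"
      by (intro suminf_le) auto
    also have "\<dots> = ennreal (e / 2)"
    proof (rule suminf_ennreal_eq)
      show "0 \<le> \<eta> (Suc n)" for n
        using \<eta>[of "Suc n"] by simp
      show "(\<lambda>n. \<eta> (Suc n)) sums (e / 2)"
        using sums_mult[OF power_half_series, of "e / 2"] by (simp add: \<eta>_def mult.assoc)
    qed
    finally show ?thesis .
  qed
  ultimately have "pending 0 + (\<Sum>n. excess n) \<le> (ennreal (1 + R 1) + ennreal (e / 2)) + ennreal (e / 2)"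
    by (rule add_mono)
  also have "\<dots> = ennreal (1 + R 1) + ennreal e"
    using e by (simp add: add.assoc ennreal_plus[symmetric] del: ennreal_plus)
  finally have total: "pending 0 + (\<Sum>n. excess n) \<le> ennreal (1 + R 1) + ennreal e" .
  have R_nonneg: "0 \<le> R 1"
    by (rule admissible_nonneg[OF R_admissible]) simp
  show ?thesis
  proof
    have "ennreal (1 + R 1) + ennreal e = ennreal (1 + R 1 + e)"
      using R_nonneg e by (intro ennreal_plus[symmetric]) auto
    with total have "pending 0 + (\<Sum>n. excess n) \<le> ennreal (1 + R 1 + e)"
      by metis
    then show "(\<kappa>, \<psi>) \<in> terminating X \<mu> f"
      unfolding terminating_iff by (rule survival_tendsto_0) (use R_nonneg e in simp)
    show "risk \<mu> f lam \<kappa> \<psi> \<le> ennreal (1 + R 1) + ennreal e"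
      using risk_le total by (rule order_trans)
  qed
qed

lemma optimal_risk:
  "(INF (\<kappa>, \<psi>)\<in>terminating X \<mu> f. risk \<mu> f lam \<kappa> \<psi>) = ennreal (1 + R 1)"
proof (rule antisym)
  show "(INF (\<kappa>, \<psi>)\<in>terminating X \<mu> f. risk \<mu> f lam \<kappa> \<psi>) \<le> ennreal (1 + R 1)"
  proof (rule ennreal_le_epsilon)
    fix e :: real assume "0 < e"
    from near_optimal_strategy[OF this] obtain \<kappa> \<psi> where "(\<kappa>, \<psi>) \<in> terminating X \<mu> f"
      "risk \<mu> f lam \<kappa> \<psi> \<le> ennreal (1 + R 1) + ennreal e" .
    then show "(INF (\<kappa>, \<psi>)\<in>terminating X \<mu> f. risk \<mu> f lam \<kappa> \<psi>) \<le> ennreal (1 + R 1) + ennreal e"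
      by (intro INF_lower2[of "(\<kappa>, \<psi>)"]) auto
  qed
  show "ennreal (1 + R 1) \<le> (INF (\<kappa>, \<psi>)\<in>terminating X \<mu> f. risk \<mu> f lam \<kappa> \<psi>)"
  proof (rule INF_greatest)
    fix s assume s: "s \<in> terminating X \<mu> f"
    obtain \<kappa> \<psi> where [simp]: "s = (\<kappa>, \<psi>)" by (cases s)
    interpret strategy_run X \<mu> f lam \<kappa> \<psi>
      using s by unfold_locales (simp add: terminating_def)
    have "ennreal (1 + R 1) \<le> pending 0 + (\<Sum>n. excess n)"
      using bound_le_pending by (rule add_increasing2[rotated]) simp
    also have "\<dots> \<le> risk \<mu> f lam \<kappa> \<psi>"
      using s by (intro risk_ge) simp
    finally show "ennreal (1 + R 1) \<le> (case s of (\<kappa>, \<psi>) \<Rightarrow> risk \<mu> f lam \<kappa> \<psi>)"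
      by simp
  qed
qed

end

text \<open>
  Both directions say when the risk equals the optimal risk, that is, when the first control is
  optimal and no later decision has positive excess (lemmas \<open>attains_bound_iff\<close> and
  \<open>optimal_risk\<close>).
\<close>

theorem theorem6p1:
  fixes X :: "'x measure" and \<mu> :: "'y measure"
    and f :: "hyp \<Rightarrow> 'x \<Rightarrow> 'y \<Rightarrow> real" and lam :: "hyp \<Rightarrow> real"
  assumes "sigma_finite_measure \<mu>"
    and "\<And>\<theta>. response_density X \<mu> (f \<theta>)"
    and "lam Th0 \<ge> 0" and "lam Th1 \<ge> 0"
    and "rho_well_defined X \<mu> f lam"
    and "R_trunc_well_defined X \<mu> f lam"
  shows
    "(\<forall>\<kappa> \<psi>. (\<kappa>, \<psi>) \<in> terminating X \<mu> f \<and> optimal X \<mu> f lam \<kappa> \<psi> \<longrightarrow>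
        (\<forall>k\<ge>1. stopping_condition X \<mu> f lam \<kappa> \<psi> k \<and> control_condition X \<mu> f lam \<kappa> \<psi> k) \<and>
        first_control_condition X \<mu> f lam \<kappa>) \<and>
     (\<forall>\<kappa> \<psi>. strategy X \<mu> \<kappa> \<psi> \<and>
        (\<forall>k\<ge>1. stopping_condition X \<mu> f lam \<kappa> \<psi> k \<and> control_condition X \<mu> f lam \<kappa> \<psi> k) \<and>
        first_control_condition X \<mu> f lam \<kappa> \<longrightarrow>
        (\<kappa>, \<psi>) \<in> terminating X \<mu> f \<and> optimal X \<mu> f lam \<kappa> \<psi>)"
proof -
  have "0 \<le> lam \<theta>" for \<theta>
    using assms(3,4) by (cases \<theta>) auto
  then interpret controlled_test X \<mu> f lam
    using assms by (intro controlled_test.intro)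
  have opt: "optimal X \<mu> f lam \<kappa> \<psi> \<longleftrightarrow> risk \<mu> f lam \<kappa> \<psi> = ennreal (1 + R 1)" for \<kappa> \<psi>
    unfolding optimal_def optimal_risk ..
  show ?thesis
  proof (rule conjI; intro allI impI)
    fix \<kappa> \<psi> assume *: "(\<kappa>, \<psi>) \<in> terminating X \<mu> f \<and> optimal X \<mu> f lam \<kappa> \<psi>"
    then interpret strategy_run X \<mu> f lam \<kappa> \<psi>
      by unfold_locales (simp add: terminating_def)
    have "pending 0 + (\<Sum>n. excess n) = ennreal (1 + R 1)"
      using * risk_le risk_ge by (intro antisym) (auto simp: opt)
    then show "(\<forall>k\<ge>1. stopping_condition X \<mu> f lam \<kappa> \<psi> k \<and> control_condition X \<mu> f lam \<kappa> \<psi> k) \<and>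
        first_control_condition X \<mu> f lam \<kappa>"
      by (rule attains_bound_iff[THEN iffD1])
  next
    fix \<kappa> \<psi> assume *: "strategy X \<mu> \<kappa> \<psi> \<and>
        (\<forall>k\<ge>1. stopping_condition X \<mu> f lam \<kappa> \<psi> k \<and> control_condition X \<mu> f lam \<kappa> \<psi> k) \<and>
        first_control_condition X \<mu> f lam \<kappa>"
    then interpret strategy_run X \<mu> f lam \<kappa> \<psi>
      by unfold_locales simp
    have bound: "pending 0 + (\<Sum>n. excess n) = ennreal (1 + R 1)"
      using * by (intro attains_bound_iff[THEN iffD2]) simp
    have terminates: "(\<kappa>, \<psi>) \<in> terminating X \<mu> f"
      unfolding terminating_iff
      using bound admissible_nonneg[OF R_admissible, of 1]
      by (intro survival_tendsto_0[of "1 + R 1"]) auto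
    moreover have "optimal X \<mu> f lam \<kappa> \<psi>"
      unfolding opt using risk_le risk_ge[OF terminates] by (simp add: bound)
    ultimately show "(\<kappa>, \<psi>) \<in> terminating X \<mu> f \<and> optimal X \<mu> f lam \<kappa> \<psi>" ..
  qed
qed

end
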